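(* Let $y \in \mathbb{R}\setminus\{0\}$ and $a\in\mathbb{C}$ with $\operatorname{Re} a > 0$. Then $$\int_0^\infty\left(1 - \tanh\left(a t\right)\right)\arctan\frac{|y|}{t}\,dt =\frac{\pi}{a}\ln\left(\frac{\Gamma\left(\frac{1}{2} + \frac{a|y|}{\pi}\right)}{\sqrt{\pi}}\right) + |y| \left(\ln\left(\frac{\pi}{a|y|}\right) + 1\right)$$ and $$\int_0^\infty \frac{\ln\left(e^{at}\operatorname{sech}(at)\right)}{t^2 + y^2} \, dt = \frac{\pi}{|y|}\ln\left(\frac{\Gamma\left(\frac{1}{2} + \frac{a|y|}{\pi}\right)}{\sqrt{\pi}}\right)+ a\left(\ln\left(\frac{\pi}{a|y|}\right) + 1\right).$$
   Context: For complex $a$, each logarithm of an expression in $a$ denotes the branch that is analytic in $a$ on the half-plane $\operatorname{Re} a>0$ and real for real $a>0$ (in particular $\ln\Gamma$ is the analytic log-gamma function). *)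

theory Defs
  imports "HOL-Complex_Analysis.Complex_Analysis"
begin

text \<open>
  \<open>ln_branch f\<close> is the logarithm of \<open>f\<close> that is analytic on the right half-plane and real on the
  positive real axis.  It is a branch of the logarithm along the function \<open>f\<close>, so it may differ
  from \<open>ln \<circ> f\<close> with the principal \<open>ln\<close> (it does for \<open>f = Gamma\<close>, where it gives \<open>ln_Gamma\<close>).
  At most one such logarithm exists (\<open>ln_branch_eqI\<close>); the value of \<open>ln_branch f a\<close> is only
  meaningful if one does exist and \<open>Re a > 0\<close>.
\<close>

definition is_ln_branch :: "(complex \<Rightarrow> complex) \<Rightarrow> (complex \<Rightarrow> complex) \<Rightarrow> bool" where
  "is_ln_branch f g \<longleftrightarrow>
     g analytic_on {z. Re z > 0} \<and>
     (\<forall>z. Re z > 0 \<longrightarrow> exp (g z) = f z) \<and>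
     (\<forall>x::real. x > 0 \<longrightarrow> g (complex_of_real x) \<in> \<real>)"

definition ln_branch :: "(complex \<Rightarrow> complex) \<Rightarrow> complex \<Rightarrow> complex" where
  "ln_branch f a = (THE w. \<exists>g. is_ln_branch f g \<and> w = g a)"

lemma is_ln_branch_unique:
  assumes "is_ln_branch f g" "is_ln_branch f h" "Re a > 0"
  shows "g a = h a"
proof -
  let ?H = "{z. Re z > 0}" and ?U = "complex_of_real ` {0<..}"
  have eq: "g z - h z = 0" if "z \<in> ?U" for z
  proof -
    obtain x where x: "x > 0" "z = complex_of_real x" using \<open>z \<in> ?U\<close> by auto
    then obtain u v where uv: "g z = complex_of_real u" "h z = complex_of_real v"
      using assms(1,2) unfolding is_ln_branch_def by (meson Reals_cases)
    have "exp (g z) = exp (h z)"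
      using assms(1,2) x unfolding is_ln_branch_def by simp
    then have "exp u = exp v"
      unfolding uv exp_of_real by (simp only: of_real_eq_iff)
    then show ?thesis using uv by simp
  qed
  have "(\<lambda>z. g z - h z) holomorphic_on ?H"
    using assms(1,2) unfolding is_ln_branch_def
    by (intro holomorphic_on_diff analytic_imp_holomorphic) auto
  moreover have "open ?H" by (rule open_halfspace_Re_gt)
  moreover have "connected ?H" by (rule convex_connected[OF convex_halfspace_Re_gt])
  moreover have "?U \<subseteq> ?H" by auto
  moreover have "1 \<in> ?H" by simp
  moreover have "1 islimpt ?U"
    unfolding islimpt_approachable
  proof (intro allI impI)
    fix e :: real assume "e > 0"
    then have "complex_of_real (1 + e/2) \<in> ?U" by (intro imageI) simp
    moreover have "complex_of_real (1 + e/2) \<noteq> 1"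
      using \<open>e > 0\<close> by (metis add_cancel_left_right half_gt_zero less_irrefl of_real_eq_1_iff)
    moreover have "dist (complex_of_real (1 + e/2)) 1 < e"
      using \<open>e > 0\<close> by (simp add: dist_norm norm_divide)
    ultimately show "\<exists>x'\<in>?U. x' \<noteq> 1 \<and> dist x' 1 < e" by blast
  qed
  ultimately have "g a - h a = 0"
    by (rule analytic_continuation) (use eq assms(3) in auto)
  then show ?thesis by simp
qed

lemma ln_branch_eqI:
  assumes "is_ln_branch f g" "Re a > 0"
  shows "ln_branch f a = g a"
  unfolding ln_branch_def
  by (rule the_equality) (use assms is_ln_branch_unique in blast)+

text \<open>Such logarithms exist for the following functions and can be expressed through library functions.\<close>

lemma ln_branch_Gamma:
  assumes "b > 0" "Re a > 0"
  shows "ln_branch (\<lambda>z. Gamma (1/2 + z * of_real b / of_real pi) / of_real (sqrt pi)) a =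
           ln_Gamma (1/2 + a * of_real b / of_real pi) - of_real (ln (sqrt pi))"
proof (rule ln_branch_eqI[OF _ assms(2)])
  have nn: "1/2 + z * of_real b / of_real pi \<notin> \<real>\<^sub>\<le>\<^sub>0" if "Re z > 0" for z :: complex
  proof -
    have "Re (1/2 + z * of_real b / of_real pi) > 0"
      using that assms(1) by (simp add: field_simps add_pos_pos)
    then show ?thesis by (auto simp: complex_nonpos_Reals_iff)
  qed
  show "is_ln_branch (\<lambda>z. Gamma (1/2 + z * of_real b / of_real pi) / of_real (sqrt pi))
     (\<lambda>a. ln_Gamma (1/2 + a * of_real b / of_real pi) - of_real (ln (sqrt pi)))"
    unfolding is_ln_branch_def
  proof (intro conjI allI impI)
    have "(\<lambda>a. ln_Gamma (1/2 + a * of_real b / of_real pi) - of_real (ln (sqrt pi)))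
            holomorphic_on {z. Re z > 0}"
      unfolding holomorphic_on_def field_differentiable_def
      using nn by (auto intro!: exI derivative_eq_intros)
    then show "(\<lambda>a. ln_Gamma (1/2 + a * of_real b / of_real pi) - of_real (ln (sqrt pi)))
            analytic_on {z. Re z > 0}"
      by (simp add: analytic_on_open open_halfspace_Re_gt)
  next
    fix z :: complex assume "Re z > 0"
    then have "1/2 + z * of_real b / of_real pi \<notin> \<int>\<^sub>\<le>\<^sub>0"
      using nn nonpos_Ints_subset_nonpos_Reals by blast
    then have "exp (ln_Gamma (1/2 + z * of_real b / of_real pi)) = Gamma (1/2 + z * of_real b / of_real pi)"
      by (metis Gamma_complex_altdef)
    moreover have "exp (complex_of_real (ln (sqrt pi))) = of_real (sqrt pi)"
      unfolding exp_of_real by (subst exp_ln) auto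
    ultimately show "exp (ln_Gamma (1/2 + z * of_real b / of_real pi) - of_real (ln (sqrt pi))) =
        Gamma (1/2 + z * of_real b / of_real pi) / of_real (sqrt pi)"
      by (simp only: exp_diff)
  next
    fix x :: real assume "x > 0"
    then have "1/2 + x * b / pi > 0" using assms(1) by (simp add: add_pos_pos)
    then have "ln_Gamma (complex_of_real (1/2 + x * b / pi)) = of_real (ln_Gamma (1/2 + x * b / pi))"
      by (rule ln_Gamma_complex_of_real)
    then show "ln_Gamma (1/2 + complex_of_real x * of_real b / of_real pi)
                 - of_real (ln (sqrt pi)) \<in> \<real>"
      by simp
  qed
qed

lemma ln_branch_inverse:
  assumes "b > 0" "Re a > 0"
  shows "ln_branch (\<lambda>z. of_real pi / (z * of_real b)) a = Ln (of_real pi / (a * of_real b))"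
proof (rule ln_branch_eqI[OF _ assms(2)])
  have nn: "of_real pi / (z * of_real b) \<notin> \<real>\<^sub>\<le>\<^sub>0" if "Re z > 0" for z :: complex
  proof -
    have "Re (of_real pi / (z * of_real b)) > 0"
      using that assms(1) by (auto simp: Re_divide intro!: divide_pos_pos mult_pos_pos add_pos_nonneg)
    then show ?thesis by (auto simp: complex_nonpos_Reals_iff)
  qed
  show "is_ln_branch (\<lambda>z. of_real pi / (z * of_real b)) (\<lambda>a. Ln (of_real pi / (a * of_real b)))"
    unfolding is_ln_branch_def
  proof (intro conjI allI impI)
    show "(\<lambda>a. Ln (of_real pi / (a * of_real b))) analytic_on {z. Re z > 0}"
      using nn assms(1) by (subst analytic_on_open[OF open_halfspace_Re_gt]) (auto intro!: holomorphic_intros)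
  next
    fix z :: complex assume "Re z > 0"
    then show "exp (Ln (of_real pi / (z * of_real b))) = of_real pi / (z * of_real b)"
      using assms(1) by (intro exp_Ln) auto
  next
    fix x :: real assume "x > 0"
    then have "Ln (complex_of_real (pi / (x * b))) = of_real (ln (pi / (x * b)))"
      using assms(1) by (intro Ln_of_real) simp
    then show "Ln (of_real pi / (complex_of_real x * of_real b)) \<in> \<real>" by simp
  qed
qed

lemma ln_branch_exp_sech:
  assumes "t > 0" "Re a > 0"
  shows "ln_branch (\<lambda>z. exp (z * of_real t) * inverse (cosh (z * of_real t))) a =
           Ln (exp (a * of_real t) * inverse (cosh (a * of_real t)))"
proof (rule ln_branch_eqI[OF _ assms(2)])
  let ?f = "\<lambda>z::complex. exp (z * of_real t) * inverse (cosh (z * of_real t))"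
  have f: "?f z = 2 / (1 + exp (- 2 * z * of_real t))" for z
  proof -
    have "cosh (z * of_real t) = exp (z * of_real t) * ((1 + exp (- 2 * z * of_real t)) / 2)"
      by (simp add: cosh_def scaleR_conv_of_real field_simps flip: exp_add)
    moreover have "u * inverse (u * (w / 2)) = 2 / w" if "u \<noteq> 0" for u w :: complex
      using that by (cases "w = 0") (auto simp: field_simps)
    ultimately show ?thesis by (metis exp_not_eq_zero)
  qed
  have pos: "Re (1 + exp (- 2 * z * of_real t)) > 0" if "Re z > 0" for z
  proof -
    have "norm (exp (- 2 * z * of_real t)) < 1" using that assms(1) by simp
    then have "\<bar>Re (exp (- 2 * z * of_real t))\<bar> < 1"
      using abs_Re_le_cmod[of "exp (- 2 * z * of_real t)"] by linarith
    then show ?thesis by simp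
  qed
  have nz: "1 + exp (- 2 * z * of_real t) \<noteq> 0" if "Re z > 0" for z
    using pos[OF that] by (metis less_irrefl zero_complex.simps(1))
  have nn: "2 / (1 + exp (- 2 * z * of_real t)) \<notin> \<real>\<^sub>\<le>\<^sub>0" if "Re z > 0" for z
  proof -
    have "Re (2 / w) > 0" if "Re w > 0" for w
      using that by (auto simp: Re_divide intro!: divide_pos_pos mult_pos_pos add_pos_nonneg)
    from this[OF pos[OF that]] show ?thesis
      unfolding complex_nonpos_Reals_iff by linarith
  qed
  show "is_ln_branch ?f (\<lambda>a. Ln (?f a))"
    unfolding f is_ln_branch_def
  proof (intro conjI allI impI)
    show "(\<lambda>a. Ln (2 / (1 + exp (- 2 * a * of_real t)))) analytic_on {z. Re z > 0}"
      using nn nz by (subst analytic_on_open[OF open_halfspace_Re_gt]) (auto intro!: holomorphic_intros)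
  next
    fix z :: complex assume "Re z > 0"
    then show "exp (Ln (2 / (1 + exp (- 2 * z * of_real t)))) = 2 / (1 + exp (- 2 * z * of_real t))"
      using nz by (intro exp_Ln) auto
  next
    fix x :: real
    have "2 / (1 + exp (- 2 * x * t)) > 0" by (simp add: add_pos_pos)
    then have "Ln (complex_of_real (2 / (1 + exp (- 2 * x * t)))) = of_real (ln (2 / (1 + exp (- 2 * x * t))))"
      by (rule Ln_of_real)
    then show "Ln (2 / (1 + exp (- 2 * complex_of_real x * of_real t))) \<in> \<real>"
      by (simp flip: exp_of_real)
  qed
qed

end

theory Submission
  imports Defs "HOL-Probability.Sinc_Integral" "HOL-Real_Asymp.Real_Asymp"
begin

text \<open>
  The second integral is computed first. Write \<open>ln (exp (a t) / cosh (a t))\<close> as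
  \<open>ln 2 - ln (1 + exp (- 2 a t))\<close>. A substitution by the positive real number \<open>\<bar>y\<bar>\<close> reduces the formula to
  \<open>\<bar>y\<bar> = 1\<close>, with \<open>a \<bar>y\<bar>\<close> in place of \<open>a\<close>. Both sides are then holomorphic in \<open>a\<close> on the right half-plane, so it is
  enough to treat real \<open>a = \<pi> x\<close> with \<open>x > 0\<close>.

  For such \<open>a\<close> the formula is a disguised form of Binet's integral for \<open>ln \<Gamma>(x + 1/2)\<close>. Expand
  \<open>ln (1 + exp (- 2 \<pi> x t))\<close> in powers of the exponential and substitute \<open>u = 2 \<pi> n t\<close> in the
  \<open>n\<close>-th term. The exponential becomes \<open>exp (- u x)\<close> in every term, and the rational factors add up to
  \<open>\<Sum>n\<ge>1. (-1)\<^sup>n\<^sup>-\<^sup>1 2 \<pi> / (u\<^sup>2 + 4 \<pi>\<^sup>2 n\<^sup>2)\<close>, which is \<open>\<pi> / u (1 / u - 1 / (2 sinh (u / 2)))\<close> by the partial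
  fraction expansion of the hyperbolic cosecant (\<open>log_integral_eq_laplace\<close>,
  \<open>csch_partial_fractions\<close>). So the integral is \<open>\<pi> ln 2 / 2 - \<pi> B(x)\<close>, where \<open>B\<close> is the Laplace
  transform of \<open>binet_kernel\<close>.

  The second derivative of \<open>B\<close> is the Laplace transform of \<open>1 - u / (2 sinh (u / 2))\<close>. Expanding the
  cosecant in exponentials shows that it equals \<open>1 / x - (\<Sum>n\<ge>0. 1 / (x + 1/2 + n)\<^sup>2)\<close>, which is also the second
  derivative of \<open>x ln x - x - ln \<Gamma>(x + 1/2)\<close>. Hence \<open>B\<close> differs from this function by an affine function. The slope
  is determined by the behaviour at infinity (\<open>laplace_id_binet_kernel\<close>) and the constant term by that at
  \<open>0\<close> (\<open>laplace_binet_kernel\<close>), where the integral visibly tends to \<open>0\<close>.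

  The first integral follows from the second by parts, since \<open>a (1 - tanh (a t))\<close> is the derivative of
  \<open>ln (exp (a t) / cosh (a t))\<close> and \<open>- y / (t\<^sup>2 + y\<^sup>2)\<close> that of \<open>arctan (y / t)\<close>
  (\<open>one_minus_tanh_arctan_by_parts\<close>).
\<close>

section \<open>Partial fractions of the cotangent and the hyperbolic cosecant\<close>

text \<open>Logarithmic derivative of \<open>\<Gamma>(z) \<Gamma>(1 - z) = \<pi> / sin (\<pi> z)\<close>.\<close>

lemma Digamma_reflection_complex:
  fixes z :: complex
  assumes "z \<notin> \<int>"
  shows "Digamma (1 - z) - Digamma z = of_real pi * cot (of_real pi * z)"
proof -
  have nz: "z \<notin> \<int>\<^sub>\<le>\<^sub>0" "1 - z \<notin> \<int>\<^sub>\<le>\<^sub>0" 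
    using assms by (metis nonpos_Ints_Int) (metis assms nonpos_Ints_Int Ints_1 Ints_diff diff_diff_eq2 add_diff_cancel_left')
  have s: "sin (of_real pi * z) \<noteq> 0"
    using assms by (auto simp: sin_eq_0)
  have "((\<lambda>z. Gamma z * Gamma (1 - z)) has_field_derivative
      Gamma z * Digamma z * Gamma (1 - z) - Gamma z * (Gamma (1 - z) * Digamma (1 - z))) (at z)"
    using nz by (auto intro!: derivative_eq_intros simp: algebra_simps)
  moreover have "((\<lambda>z::complex. of_real pi / sin (of_real pi * z)) has_field_derivative
      - (of_real pi * (cos (of_real pi * z) * of_real pi)) / (sin (of_real pi * z))^2) (at z)"
    using s by (auto intro!: derivative_eq_intros simp: power2_eq_square)
  ultimately have "Gamma z * Digamma z * Gamma (1 - z) - Gamma z * (Gamma (1 - z) * Digamma (1 - z))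
     = - (of_real pi * (cos (of_real pi * z) * of_real pi)) / (sin (of_real pi * z))^2"
    unfolding Gamma_reflection_complex by (rule DERIV_unique)
  also have "Gamma z * Digamma z * Gamma (1 - z) - Gamma z * (Gamma (1 - z) * Digamma (1 - z))
     = (Gamma z * Gamma (1 - z)) * (Digamma z - Digamma (1 - z))" by (simp add: algebra_simps)
  finally have *: "of_real pi / sin (of_real pi * z) * (Digamma z - Digamma (1 - z)) =
      - (of_real pi * (cos (of_real pi * z) * of_real pi)) / (sin (of_real pi * z))^2"
    unfolding Gamma_reflection_complex .
  have "Digamma (1 - z) - Digamma z = - (sin (of_real pi * z) / of_real pi *
          (of_real pi / sin (of_real pi * z) * (Digamma z - Digamma (1 - z))))"
    using s by simp
  also have "\<dots> = of_real pi * cot (of_real pi * z)"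
    unfolding * using s by (simp add: cot_def power2_eq_square)
  finally show ?thesis .
qed

text \<open>Subtracting the series of \<open>Digamma (1 - z)\<close> and \<open>Digamma (1 + z)\<close> term by term removes
  Euler's constant and leaves a rational function of \<open>z\<^sup>2\<close>; the reflection formula identifies the difference.\<close>

lemma cot_partial_fractions:
  fixes z :: complex
  assumes "z \<notin> \<int>"
  shows "(\<lambda>n. 2 * z / (of_nat (Suc n) ^ 2 - z ^ 2)) sums (1 / z - of_real pi * cot (of_real pi * z))"
proof -
  have ni: "1 - z \<noteq> 0" "1 + z \<noteq> 0" "z \<noteq> 0" using assms 
    by (auto simp: eq_diff_eq add_eq_0_iff)
  have "(\<lambda>n. inverse (of_nat (Suc n)) - inverse (1 - z + of_nat n)) sums (Digamma (1 - z) + euler_mascheroni)"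
    using summable_Digamma[OF ni(1)] by (simp add: Digamma_def summable_sums)
  moreover have "(\<lambda>n. inverse (of_nat (Suc n)) - inverse (1 + z + of_nat n)) sums (Digamma (1 + z) + euler_mascheroni)"
    using summable_Digamma[OF ni(2)] by (simp add: Digamma_def summable_sums)
  ultimately have "(\<lambda>n. (inverse (of_nat (Suc n)) - inverse (1 + z + of_nat n)) - (inverse (of_nat (Suc n)) - inverse (1 - z + of_nat n))) sums
      ((Digamma (1 + z) + euler_mascheroni) - (Digamma (1 - z) + euler_mascheroni))"
    by (intro sums_diff)
  hence "(\<lambda>n. inverse (1 - z + of_nat n) - inverse (1 + z + of_nat n)) sums
      (Digamma (1 + z) - Digamma (1 - z))"
    by simp
  moreover have "inverse (1 - z + of_nat n) - inverse (1 + z + of_nat n) 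
      = 2 * z / (of_nat (Suc n) ^ 2 - z ^ 2)" for n
  proof -
    have "z = of_int (1 + int n)" if "1 - z + of_nat n = 0" using that by (simp add: algebra_simps)
    moreover have "z = of_int (- 1 - int n)" if "1 + z + of_nat n = 0" 
      using that by (simp add: algebra_simps eq_neg_iff_add_eq_0)
    ultimately have "1 - z + of_nat n \<noteq> 0" "1 + z + of_nat n \<noteq> 0"
      using assms Ints_of_int by metis+
    moreover have "of_nat (Suc n) ^ 2 - z ^ 2 = (1 - z + of_nat n) * (1 + z + of_nat n)"
      by (simp add: algebra_simps power2_eq_square)
    ultimately show ?thesis by (simp add: divide_simps)
  qed
  moreover have "Digamma (1 + z) - Digamma (1 - z) = 1 / z - of_real pi * cot (of_real pi * z)"
    using Digamma_reflection_complex[OF assms] Digamma_plus1[OF ni(3)]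
    by (simp add: add.commute) (simp add: algebra_simps)
  ultimately show ?thesis by simp
qed

text \<open>The cotangent series on the imaginary axis, at \<open>z = \<i> u / (2 \<pi>)\<close>, multiplied by \<open>- z\<close>.\<close>

lemma coth_partial_fractions:
  fixes u :: real
  assumes "u > 0"
  shows "(\<lambda>n. 2 * u^2 / (u^2 + 4 * pi^2 * real (Suc n) ^ 2)) sums (u / 2 * cosh (u/2) / sinh (u/2) - 1)"
proof -
  define z where "z = \<i> * complex_of_real (u / (2 * pi))"
  have zI: "z \<notin> \<int>" using assms by (auto simp: z_def Ints_def complex_eq_iff)
  have pz: "of_real pi * z = \<i> * of_real (u/2)" by (simp add: z_def)
  have z2: "z ^ 2 = - of_real (u^2 / (4 * pi^2))" by (simp add: z_def power_mult_distrib power_divide)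
  have z0: "z \<noteq> 0" using zI by auto
  have "(\<lambda>n. - z * (2 * z / (of_nat (Suc n) ^ 2 - z ^ 2))) sums (- z * (1 / z - of_real pi * cot (of_real pi * z)))"
    using cot_partial_fractions[OF zI] by (rule sums_mult)
  moreover have "- z * (2 * z / (of_nat (Suc n) ^ 2 - z ^ 2)) 
        = of_real (2 * u^2 / (u^2 + 4 * pi^2 * real (Suc n) ^ 2))" for n
  proof -
    have "- z * (2 * z / (of_nat (Suc n) ^ 2 - z ^ 2)) = - 2 * z^2 / (of_nat (Suc n) ^ 2 - z ^ 2)"
      by (simp add: power2_eq_square)
    also have "\<dots> = of_real (2 * (u^2 / (4 * pi^2)) / (real (Suc n) ^ 2 + u^2 / (4 * pi^2)))"
      unfolding z2 by simp
    also have "2 * (u^2 / (4 * pi^2)) / (real (Suc n) ^ 2 + u^2 / (4 * pi^2)) = 2 * u^2 / (u^2 + 4 * pi^2 * real (Suc n) ^ 2)"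
    proof -
      have "u\<^sup>2 / (4 * pi\<^sup>2) + real (Suc n) ^ 2 > 0" "u\<^sup>2 + 4 * pi\<^sup>2 * real (Suc n) ^ 2 > 0" 
        using assms by (auto intro!: add_pos_nonneg)
      thus ?thesis by (simp add: divide_simps)
    qed
    finally show ?thesis .
  qed
  moreover have "- z * (1 / z - of_real pi * cot (of_real pi * z)) = of_real (u / 2 * cosh (u/2) / sinh (u/2) - 1)"
  proof -
    have "- z * (1 / z - of_real pi * cot (of_real pi * z)) = (of_real pi * z) * cot (of_real pi * z) - 1"
      using z0 by (simp add: algebra_simps)
    moreover have "(of_real pi * z) * cot (of_real pi * z) = of_real (u / 2 * cosh (u/2) / sinh (u/2))"
    proof -
      have "sinh (u/2) \<noteq> 0" using assms by simp
      moreover have "cosh (complex_of_real (u/2)) = of_real (cosh (u/2))" "sinh (complex_of_real (u/2)) = of_real (sinh (u/2))"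
        by (simp_all add: cosh_def sinh_def scaleR_conv_of_real exp_of_real[symmetric])
      moreover have "cos (\<i> * complex_of_real (u/2)) = cosh (complex_of_real (u/2))" 
          "sin (\<i> * complex_of_real (u/2)) = \<i> * sinh (complex_of_real (u/2))"
        by (simp_all only: cosh_conv_cos sinh_conv_sin) simp_all
      ultimately show ?thesis unfolding pz cot_def by simp
    qed
    ultimately show ?thesis by simp
  qed
  ultimately have "(\<lambda>n. complex_of_real (2 * u^2 / (u^2 + 4 * pi^2 * real (Suc n) ^ 2))) sums of_real (u / 2 * cosh (u/2) / sinh (u/2) - 1)"
    by simp
  thus ?thesis by (simp only: sums_of_real_iff)
qed

text \<open>Counting terms from 1, changing the sign of the even-numbered ones amounts to subtracting them twice. They form the
  same series at \<open>u / 2\<close>, so the alternating sum is a combination of two values of \<open>coth\<close>, and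
  \<open>1 / sinh (2 v) = coth v - coth (2 v)\<close>.\<close>

lemma csch_partial_fractions:
  fixes u :: real
  assumes "u > 0"
  shows "(\<lambda>n. (-1)^n * (2 * u^2 / (u^2 + 4 * pi^2 * real (Suc n) ^ 2))) sums (1 - u / (2 * sinh (u/2)))"
proof -
  let ?c = "\<lambda>n. 2 * u^2 / (u^2 + 4 * pi^2 * real (Suc n) ^ 2)"
  let ?d = "\<lambda>n. 2 * (u/2)^2 / ((u/2)^2 + 4 * pi^2 * real (Suc n) ^ 2)"
  \<comment> \<open>The terms with odd index \<open>n = 2 m + 1\<close>, that is with \<open>Suc n = 2 Suc m\<close>, are those of the series at \<open>u / 2\<close>.\<close>
  have "?d sums (u / 4 * cosh (u/4) / sinh (u/4) - 1)"
    using coth_partial_fractions[of "u/2"] assms by simp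
  from sums_if'[OF this] 
  have "(\<lambda>n. ?c n - 2 * (if even n then 0 else ?d ((n - 1) div 2))) sums
      ((u / 2 * cosh (u/2) / sinh (u/2) - 1) - 2 * (u / 4 * cosh (u/4) / sinh (u/4) - 1))"
    by (intro sums_diff sums_mult coth_partial_fractions assms)
  moreover have "?c n - 2 * (if even n then 0 else ?d ((n - 1) div 2)) = (-1)^n * ?c n" for n
  proof (cases "even n")
    case False
    then obtain m where n: "n = 2 * m + 1" by (rule oddE)
    have "?d m = ?c (2 * m + 1)"
    proof -
      have "u\<^sup>2 + 4 * pi\<^sup>2 * real (Suc (2*m+1)) ^ 2 = 4 * ((u/2)^2 + 4 * pi^2 * real (Suc m) ^ 2)"
        by (simp add: algebra_simps power2_eq_square)
      moreover have "2 * u^2 / (4 * ((u/2)^2 + 4 * pi^2 * real (Suc m) ^ 2)) = ?d m"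
        by (simp only: divide_divide_eq_left[symmetric]) (simp add: power_divide)
      ultimately show ?thesis by metis
    qed
    thus ?thesis by (simp add: n)
  qed simp
  moreover have "(u / 2 * cosh (u/2) / sinh (u/2) - 1) - 2 * (u / 4 * cosh (u/4) / sinh (u/4) - 1) = 1 - u / (2 * sinh (u/2))"
  proof -
    have s: "sinh (u/2) = 2 * sinh (u/4) * cosh (u/4)" "cosh (u/2) = 2 * cosh (u/4)^2 - 1"
      using sinh_double[of "u/4"] cosh_double_cosh[of "u/4"] by simp_all
    have "sinh (u/4) \<noteq> 0" "cosh (u/4) \<noteq> 0" using assms by (simp_all)
    thus ?thesis unfolding s by (simp add: field_simps power2_eq_square)
  qed
  ultimately show ?thesis by simp
qed

section \<open>Laplace integrals on the positive half-line\<close>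

definition laplace :: "(real \<Rightarrow> real) \<Rightarrow> real \<Rightarrow> real" where
  "laplace h x = (LINT u:{0<..}|lborel. exp (- (u * x)) * h u)"

text \<open>Half of the exponential decay absorbs the factor \<open>u\<^sup>2\<close>: from \<open>v\<^sup>2 / 2 \<le> exp v\<close> at \<open>v = s u / 2\<close>.\<close>

lemma set_integrable_exp_power2:
  fixes s :: real
  assumes "s > 0"
  shows "set_integrable lborel {0<..} (\<lambda>u. exp (- (u * s)) * u\<^sup>2)"
proof (rule set_integrable_bound)
  show "set_integrable lborel {0<..} (\<lambda>u. 8 / s\<^sup>2 * exp (- (u * (s / 2))))"
    using integrable_I0i_exp_mscale[of "s/2"] assms by (intro set_integrable_mult_right) auto
  show "AE u in lborel. u \<in> {0<..} \<longrightarrow> norm (exp (- (u * s)) * u\<^sup>2) \<le> norm (8 / s\<^sup>2 * exp (- (u * (s / 2))))"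
  proof (rule AE_I2, rule impI)
    fix u :: real assume "u \<in> {0<..}"
    then have "1 + u * (s/2) + (u * (s/2))\<^sup>2 / 2 \<le> exp (u * (s / 2))"
      using assms by (intro exp_lower_Taylor_quadratic) simp
    moreover have "u * (s/2) > 0" using \<open>u \<in> {0<..}\<close> assms by simp
    ultimately have "(u * (s/2))\<^sup>2 / 2 \<le> exp (u * (s / 2))" by linarith
    hence "u\<^sup>2 \<le> 8 / s\<^sup>2 * exp (u * (s / 2))"
      using assms by (simp add: field_simps power2_eq_square)
    hence "exp (- (u * s)) * u\<^sup>2 \<le> exp (- (u * s)) * (8 / s\<^sup>2 * exp (u * (s / 2)))"
      by (intro mult_left_mono) auto
    also have "\<dots> = 8 / s\<^sup>2 * exp (- (u * (s / 2)))"
      by (simp add: mult_exp_exp)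
    finally show "norm (exp (- (u * s)) * u\<^sup>2) \<le> norm (8 / s\<^sup>2 * exp (- (u * (s / 2))))"
      by simp
  qed
qed (simp add: set_borel_measurable_def)

lemma laplace_integrable:
  fixes h :: "real \<Rightarrow> real"
  assumes "x > 0" "h \<in> borel_measurable borel" "\<And>u. u > 0 \<Longrightarrow> \<bar>h u\<bar> \<le> C * (1 + u^2)"
  shows "set_integrable lborel {0<..} (\<lambda>u. exp (- (u * x)) * h u)"
proof (rule set_integrable_bound)
  have "set_integrable lborel {0<..} (\<lambda>u. C * (exp (- (u * x)) + exp (- (u * x)) * u\<^sup>2))"
    by (intro set_integrable_mult_right set_integral_add(1) integrable_I0i_exp_mscale[OF assms(1)] set_integrable_exp_power2[OF assms(1)])
  thus "set_integrable lborel {0<..} (\<lambda>u. exp (- (u * x)) * (C * (1 + u\<^sup>2)))"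
    by (simp add: algebra_simps)
  show "AE u in lborel. u \<in> {0<..} \<longrightarrow> norm (exp (- (u * x)) * h u) \<le> norm (exp (- (u * x)) * (C * (1 + u\<^sup>2)))"
    using assms(3) by (auto simp: abs_mult intro!: AE_I2 order_trans[OF assms(3)] mult_right_mono)
qed (use assms(2) in \<open>simp add: set_borel_measurable_def\<close>)

lemma exp_minus_linear_bound:
  fixes v :: real
  shows "\<bar>exp v - 1 - v\<bar> \<le> exp \<bar>v\<bar> * v\<^sup>2"
proof -
  obtain t where t: "\<bar>t\<bar> \<le> \<bar>v\<bar>" "exp v = (\<Sum>m<2. v ^ m / fact m) + exp t / fact 2 * v ^ 2"
    using Maclaurin_exp_le by blast
  hence "\<bar>exp v - 1 - v\<bar> = exp t / 2 * v\<^sup>2" by (simp add: numeral_2_eq_2)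
  also have "\<dots> \<le> exp \<bar>v\<bar> * v\<^sup>2" 
  proof (rule mult_right_mono)
    have "exp t \<le> exp \<bar>v\<bar>" using t(1) by simp
    moreover have "exp t / 2 \<le> exp t" by simp
    ultimately show "exp t / 2 \<le> exp \<bar>v\<bar>" by linarith
  qed simp
  finally show ?thesis .
qed

text \<open>Differentiation under the integral sign. The second-order Taylor remainder of the exponential
  bounds the error of the difference quotient by \<open>\<bar>d\<bar> C u\<^sup>2 exp (- u x / 2)\<close> as soon as
  \<open>\<bar>d\<bar> < x / 2\<close>, and this is integrable with an integral that is linear in \<open>\<bar>d\<bar>\<close>.\<close>

lemma laplace_has_derivative:
  fixes h :: "real \<Rightarrow> real"
  assumes "x > 0" and h: "h \<in> borel_measurable borel" and bd: "\<And>u. u > 0 \<Longrightarrow> \<bar>h u\<bar> \<le> C"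
  shows "(laplace h has_real_derivative - laplace (\<lambda>u. u * h u) x) (at x)"
proof -
  have C0: "C \<ge> 0" using bd[of 1] by simp
  define D where "D = (LINT u:{0<..}|lborel. exp (- (u * (x/2))) * u\<^sup>2)"
  have ih: "set_integrable lborel {0<..} (\<lambda>u. exp (- (u * y)) * h u)" if "y > 0" for y
  proof (rule laplace_integrable[where C = C])
    show "\<bar>h u\<bar> \<le> C * (1 + u\<^sup>2)" if "u > 0" for u
      using bd[OF that] mult_left_mono[OF _ C0, of 1 "1 + u^2"] by simp
  qed (use that h in auto)
  have iuh: "set_integrable lborel {0<..} (\<lambda>u. exp (- (u * x)) * (u * h u))"
  proof (rule laplace_integrable[where C = C])
    show "\<bar>u * h u\<bar> \<le> C * (1 + u\<^sup>2)" if "u > 0" for u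
    proof -
      have "u \<le> 1 + u^2" using sum_squares_bound[of u 1] that by simp
      hence "u * \<bar>h u\<bar> \<le> (1 + u^2) * C" using bd[OF that] C0 that by (intro mult_mono) auto
      thus ?thesis using that by (simp add: abs_mult mult.commute)
    qed
  qed (use assms in auto)
  have est: "norm ((laplace h (x + d) - laplace h x) / d - (- laplace (\<lambda>u. u * h u) x)) \<le> \<bar>d\<bar> * (C * D)"
    if d: "d \<noteq> 0" "\<bar>d\<bar> < x / 2" for d
  proof -
    have xd: "x + d > 0" using d assms(1) by linarith
    define q where "q = (\<lambda>u. (exp (- (u * (x + d))) * h u - exp (- (u * x)) * h u) / d + exp (- (u * x)) * (u * h u))"
    have iq: "set_integrable lborel {0<..} q"
      unfolding q_def by (intro set_integral_add(1) set_integrable_divide set_integral_diff(1) ih xd iuh assms(1))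
    have eq: "(laplace h (x + d) - laplace h x) / d - (- laplace (\<lambda>u. u * h u) x) = (LINT u:{0<..}|lborel. q u)"
      unfolding laplace_def q_def
      by (subst set_integral_add(2))
         (use ih[OF xd] ih[OF assms(1)] iuh in \<open>auto simp: set_integral_diff(2)\<close>)
    have "norm (LINT u:{0<..}|lborel. q u) \<le> (LINT u:{0<..}|lborel. norm (q u))"
      by (rule set_integral_norm_bound[OF iq])
    also have "\<dots> \<le> (LINT u:{0<..}|lborel. \<bar>d\<bar> * (C * (exp (- (u * (x/2))) * u\<^sup>2)))"
    proof (rule set_integral_mono)
      show "set_integrable lborel {0<..} (\<lambda>u. norm (q u))"
        using set_integrable_abs[OF iq] by simp
      show "set_integrable lborel {0<..} (\<lambda>u. \<bar>d\<bar> * (C * (exp (- (u * (x/2))) * u\<^sup>2)))"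
        using assms(1) by (intro set_integrable_mult_right set_integrable_exp_power2) auto
      fix u :: real assume "u \<in> {0<..}" hence u: "u > 0" by simp
      have e: "exp (- (u * (x + d))) = exp (- (u * x)) * exp (- (d * u))"
        by (simp add: mult_exp_exp algebra_simps)
      have "q u = exp (- (u * x)) * h u * (exp (- (d * u)) - 1 - (- (d * u))) / d"
        unfolding e q_def using d(1) by (simp add: field_simps)
      hence "norm (q u) = exp (- (u * x)) * \<bar>h u\<bar> * \<bar>exp (- (d * u)) - 1 - (- (d * u))\<bar> / \<bar>d\<bar>"
        by (simp add: abs_mult)
      also have "\<dots> \<le> exp (- (u * x)) * C * (exp \<bar>- (d * u)\<bar> * (- (d * u))\<^sup>2) / \<bar>d\<bar>"
        using bd[OF u] C0 exp_minus_linear_bound[of "- (d * u)"] by (intro divide_right_mono mult_mono) auto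
      also have "\<dots> = \<bar>d\<bar> * C * (exp (- (u * x)) * exp (\<bar>d\<bar> * u)) * u\<^sup>2"
        using d u by (simp add: abs_mult power2_eq_square field_simps)
      finally have nq: "norm (q u) \<le> \<bar>d\<bar> * C * (exp (- (u * x)) * exp (\<bar>d\<bar> * u)) * u\<^sup>2" .
      have "exp (- (u * x)) * exp (\<bar>d\<bar> * u) \<le> exp (- (u * (x / 2)))"
        using d mult_right_mono[of "\<bar>d\<bar>" "x/2" u] u by (simp add: mult_exp_exp algebra_simps)
      hence "\<bar>d\<bar> * C * (exp (- (u * x)) * exp (\<bar>d\<bar> * u)) * u\<^sup>2 \<le> \<bar>d\<bar> * C * exp (- (u * (x / 2))) * u\<^sup>2"
        using C0 by (intro mult_right_mono mult_left_mono) auto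
      with nq show "norm (q u) \<le> \<bar>d\<bar> * (C * (exp (- (u * (x/2))) * u\<^sup>2))"
        by (simp add: mult.assoc)
    qed
    also have "\<dots> = \<bar>d\<bar> * (C * D)" by (simp add: D_def)
    finally show ?thesis unfolding eq .
  qed
  have "((\<lambda>d. (laplace h (x + d) - laplace h x) / d - (- laplace (\<lambda>u. u * h u) x)) \<longlongrightarrow> 0) (at 0)"
  proof (rule Lim_null_comparison)
    have "\<forall>\<^sub>F d in at (0::real). dist d 0 < x/2 \<and> d \<noteq> 0"
      using assms(1) by (auto simp: eventually_at intro!: exI[of _ "x/2"])
    thus "\<forall>\<^sub>F d in at 0. norm ((laplace h (x + d) - laplace h x) / d - (- laplace (\<lambda>u. u * h u) x)) \<le> \<bar>d\<bar> * (C * D)"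
      by eventually_elim (use est in auto)
    have "((\<lambda>d::real. \<bar>d\<bar> * (C * D)) \<longlongrightarrow> \<bar>0\<bar> * (C * D)) (at 0)"
      by (intro tendsto_intros)
    thus "((\<lambda>d::real. \<bar>d\<bar> * (C * D)) \<longlongrightarrow> 0) (at 0)" by simp
  qed
  thus ?thesis unfolding DERIV_def by (rule LIM_zero_cancel)
qed

lemma laplace_1:
  assumes "x > 0"
  shows "laplace (\<lambda>_. 1) x = 1 / x"
  using LBINT_I0i_exp_mscale[OF assms] by (simp add: laplace_def interval_lebesgue_integral_0_infty)

text \<open>Obtained by differentiating the Laplace transform of the constant 1.\<close>

lemma laplace_id:
  assumes "x > 0"
  shows "laplace (\<lambda>u. u) x = 1 / x\<^sup>2"
proof -
  have "(laplace (\<lambda>_. 1) has_real_derivative - laplace (\<lambda>u. u * 1) x) (at x)"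
    by (rule laplace_has_derivative[where C = 1]) (use assms in auto)
  moreover have "(laplace (\<lambda>_. 1) has_real_derivative - (1 / x\<^sup>2)) (at x)"
  proof (rule has_field_derivative_transform_within_open[where S = "{0<..}"])
    show "((\<lambda>x. 1 / x) has_real_derivative - (1 / x\<^sup>2)) (at x)"
      using assms by (auto intro!: derivative_eq_intros simp: power2_eq_square)
  qed (use assms in \<open>auto simp: laplace_1\<close>)
  ultimately show ?thesis using DERIV_unique by fastforce
qed

section \<open>The kernel of the Binet integral\<close>

text \<open>For \<open>u \<noteq> 0\<close> this is \<open>(1 / u - 1 / (2 sinh (u / 2))) / u\<close>, the kernel of Binet's first integral
  for \<open>ln \<Gamma>(x + 1/2)\<close>. The series form makes boundedness near \<open>u = 0\<close> and measurability obvious,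
  and it is the form that meets the expansion of \<open>ln (1 + exp (- 2 a t))\<close> below.\<close>

definition binet_kernel :: "real \<Rightarrow> real" where
  "binet_kernel u = 2 * (\<Sum>n. (-1)^n / (u\<^sup>2 + 4 * pi\<^sup>2 * real (Suc n) ^ 2))"

lemma norm_binet_kernel_term_le:
  "\<bar>(-1)^n / (u\<^sup>2 + 4 * pi\<^sup>2 * real (Suc n) ^ 2)\<bar> \<le> 1 / real (Suc n) ^ 2"
proof -
  have "real (Suc n) ^ 2 \<le> 4 * pi\<^sup>2 * real (Suc n) ^ 2"
  proof -
    have "1 \<le> pi\<^sup>2" using pi_ge_two by (intro one_le_power) simp
    hence "1 * real (Suc n) ^ 2 \<le> (4 * pi\<^sup>2) * real (Suc n) ^ 2" by (intro mult_right_mono) auto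
    thus ?thesis by simp
  qed
  hence *: "real (Suc n) ^ 2 \<le> u\<^sup>2 + 4 * pi\<^sup>2 * real (Suc n) ^ 2" using zero_le_power2[of u] by linarith
  have "real (Suc n) ^ 2 > 0" by simp
  hence "1 / (u\<^sup>2 + 4 * pi\<^sup>2 * real (Suc n) ^ 2) \<le> 1 / real (Suc n) ^ 2"
    using * by (intro divide_left_mono mult_pos_pos) linarith+
  thus ?thesis using * by (simp add: abs_mult)
qed

lemma summable_inverse_Suc_power2: "summable (\<lambda>n. 1 / real (Suc n) ^ 2)"
  using inverse_power_summable[of 2, where 'a = real]
    summable_Suc_iff[of "\<lambda>n. inverse (real n ^ 2)"] by (simp only: divide_inverse mult_1 of_nat_id)

lemma summable_binet_kernel:
  "summable (\<lambda>n. \<bar>(-1)^n / (u\<^sup>2 + 4 * pi\<^sup>2 * real (Suc n) ^ 2)\<bar>)"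
proof (rule summable_comparison_test'[OF summable_inverse_Suc_power2, of 0])
  show "norm \<bar>(-1)^n / (u\<^sup>2 + 4 * pi\<^sup>2 * real (Suc n) ^ 2)\<bar> \<le> 1 / real (Suc n) ^ 2" for n
    unfolding real_norm_def abs_idempotent by (rule norm_binet_kernel_term_le)
qed

lemma binet_kernel_sums:
  "(\<lambda>n. 2 * ((-1)^n / (u\<^sup>2 + 4 * pi\<^sup>2 * real (Suc n) ^ 2))) sums binet_kernel u"
  unfolding binet_kernel_def
  by (rule sums_mult[OF summable_sums[OF summable_rabs_cancel[OF summable_binet_kernel]]])

lemma power2_binet_kernel:
  assumes "u > 0"
  shows "u\<^sup>2 * binet_kernel u = 1 - u / (2 * sinh (u / 2))"
proof (rule sums_unique2)
  show "(\<lambda>n. u\<^sup>2 * (2 * ((-1)^n / (u\<^sup>2 + 4 * pi\<^sup>2 * real (Suc n) ^ 2)))) sums (u\<^sup>2 * binet_kernel u)"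
    by (intro sums_mult binet_kernel_sums)
  show "(\<lambda>n. u\<^sup>2 * (2 * ((-1)^n / (u\<^sup>2 + 4 * pi\<^sup>2 * real (Suc n) ^ 2)))) sums (1 - u / (2 * sinh (u / 2)))"
    using csch_partial_fractions[OF assms] by (simp add: mult_ac)
qed

lemma half_csch_bounds:
  fixes u :: real
  assumes "u > 0"
  shows "0 < u / (2 * sinh (u / 2))" "u / (2 * sinh (u / 2)) \<le> 2"
proof -
  have "sinh (u/2) > 0" using assms by simp
  thus "0 < u / (2 * sinh (u / 2))" using assms by simp
  have "1 + u/2 \<le> exp (u/2)" by (rule exp_ge_add_one_self)
  moreover have "exp (- (u/2)) \<le> 1" using assms by simp
  moreover have "2 * sinh (u/2) = exp (u/2) - exp (- (u/2))" by (simp add: sinh_def)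
  ultimately have "u / 2 \<le> 2 * sinh (u/2)" by linarith
  thus "u / (2 * sinh (u / 2)) \<le> 2" using \<open>sinh (u/2) > 0\<close> by (simp add: field_simps)
qed

lemma binet_kernel_measurable [measurable]: "binet_kernel \<in> borel_measurable borel"
  unfolding binet_kernel_def by measurable

text \<open>These bounds are what allows the Laplace transform of the kernel to be differentiated twice.
  The series gives the first one, and hence the second one for \<open>u \<le> 1\<close>. For \<open>u > 1\<close> the second one holds
  because \<open>u\<^sup>2 * binet_kernel u\<close> is bounded, by its closed form.\<close>

lemma binet_kernel_bounded:
  obtains C where "\<And>u. \<bar>binet_kernel u\<bar> \<le> C" "\<And>u. u > 0 \<Longrightarrow> \<bar>u * binet_kernel u\<bar> \<le> C"
proof -
  define K where "K = 2 * (\<Sum>n. 1 / real (Suc n) ^ 2)"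
  have 0: "\<bar>binet_kernel u\<bar> \<le> K" for u
  proof -
    have "\<bar>\<Sum>n. (-1)^n / (u\<^sup>2 + 4 * pi\<^sup>2 * real (Suc n) ^ 2)\<bar> \<le> (\<Sum>n. \<bar>(-1)^n / (u\<^sup>2 + 4 * pi\<^sup>2 * real (Suc n) ^ 2)\<bar>)"
      by (rule summable_rabs[OF summable_binet_kernel])
    also have "\<dots> \<le> (\<Sum>n. 1 / real (Suc n) ^ 2)"
      by (rule suminf_le[OF norm_binet_kernel_term_le summable_binet_kernel summable_inverse_Suc_power2])
    finally show ?thesis by (simp add: binet_kernel_def K_def abs_mult)
  qed
  have 2: "\<bar>u * (u * binet_kernel u)\<bar> \<le> 1" if "u > 0" for u
    using power2_binet_kernel[OF that] half_csch_bounds[OF that] by (simp add: power2_eq_square mult.assoc)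
  have 1: "\<bar>u * binet_kernel u\<bar> \<le> K + 1" if "u > 0" for u
  proof (cases "u \<le> 1")
    case True
    hence "u * \<bar>binet_kernel u\<bar> \<le> 1 * K" using 0[of u] that by (intro mult_mono) auto
    thus ?thesis using that by (simp add: abs_mult)
  next
    case False
    hence "1 * \<bar>u * binet_kernel u\<bar> \<le> u * \<bar>u * binet_kernel u\<bar>" by (intro mult_right_mono) auto
    thus ?thesis using 2[OF that] 0[of u] that by (simp only: abs_mult) linarith
  qed
  show ?thesis
  proof (rule that[of "K + 1"])
    show "\<bar>binet_kernel u\<bar> \<le> K + 1" for u using 0[of u] by linarith
    show "\<bar>u * binet_kernel u\<bar> \<le> K + 1" if "u > 0" for u using 1[OF that] .
  qed
qed

text \<open>Expanding \<open>1 / (2 sinh (u / 2)) = (\<Sum>n. exp (- (n + 1/2) u))\<close> and integrating the nonnegative terms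
  one by one produces the series \<open>\<Sum>n. 1 / (x + 1/2 + n)\<^sup>2\<close> of the trigamma function.\<close>

lemma laplace_half_csch:
  fixes x :: real
  assumes "x > 0"
  shows "laplace (\<lambda>u. u / (2 * sinh (u / 2))) x = Polygamma 1 (x + 1/2)"
proof -
  define f where "f = (\<lambda>n u. exp (- (u * (x + 1/2 + real n))) * (u :: real))"
  have pos: "x + 1/2 + real n > 0" for n using assms by linarith
  have int: "integrable lborel (\<lambda>u. indicator {0<..} u *\<^sub>R f n u)" for n
  proof -
    have "\<bar>u\<bar> \<le> 1 * (1 + u\<^sup>2)" if "u > 0" for u :: real
      using sum_squares_bound[of u 1] that by simp
    hence "set_integrable lborel {0<..} (f n)"
      unfolding f_def by (intro laplace_integrable[OF pos[of n], of "\<lambda>u. u" 1]) auto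
    thus ?thesis by (simp only: set_integrable_def)
  qed
  have val: "(LINT u|lborel. indicator {0<..} u *\<^sub>R f n u) = inverse ((x + 1/2 + real n)\<^sup>2)" for n
    using laplace_id[OF pos[of n]]
    unfolding laplace_def f_def set_lebesgue_integral_def by (simp only: divide_inverse mult_1)
  have summ: "summable (\<lambda>n. inverse ((x + 1/2 + real n)\<^sup>2))"
    using Polygamma_converges'[of "x + 1/2" 2] assms by simp
  have geo: "(\<lambda>n. indicator {0<..} u *\<^sub>R f n u) sums (indicator {0<..} u *\<^sub>R (exp (- (u * x)) * (u / (2 * sinh (u / 2)))))" for u
  proof (cases "u > 0")
    case True
    hence e1: "exp (- u) < 1" by simp
    have "(\<lambda>n. (exp (- (u * (x + 1/2))) * u) * exp (- u) ^ n) sums ((exp (- (u * (x + 1/2))) * u) * (1 / (1 - exp (- u))))"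
      using e1 by (intro sums_mult geometric_sums) auto
    moreover have "(exp (- (u * (x + 1/2))) * u) * exp (- u) ^ n = f n u" for n
    proof -
      have "- (u * (x + 1/2 + real n)) = - (u * (x + 1/2)) + real n * (- u)" by (simp add: algebra_simps)
      hence "exp (- (u * (x + 1/2 + real n))) = exp (- (u * (x + 1/2))) * exp (- u) ^ n"
        by (simp only: exp_add exp_of_nat_mult)
      thus ?thesis by (simp add: f_def)
    qed
    moreover have "(exp (- (u * (x + 1/2))) * u) * (1 / (1 - exp (- u))) = exp (- (u * x)) * (u / (2 * sinh (u / 2)))"
    proof -
      have "exp (- (u / 2)) = exp (u / 2) * exp (- u)"
        by (simp add: mult_exp_exp)
      hence "2 * sinh (u/2) = exp (u / 2) * (1 - exp (- u))"
        by (simp add: sinh_def right_diff_distrib)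
      moreover have "- (u * (x + 1/2)) = - (u * x) - u / 2" by (simp add: algebra_simps)
      hence "exp (- (u * (x + 1/2))) = exp (- (u * x)) / exp (u / 2)"
        by (simp only: exp_diff)
      ultimately show ?thesis by simp
    qed
    ultimately show ?thesis using True by simp
  qed simp
  have "(\<lambda>n. LINT u|lborel. indicator {0<..} u *\<^sub>R f n u) sums (LINT u|lborel. (\<Sum>n. indicator {0<..} u *\<^sub>R f n u))"
  proof (rule sums_integral)
    have nf: "norm (indicator {0<..} u *\<^sub>R f n u) = indicator {0<..} u *\<^sub>R f n u" for n u
      by (auto simp: f_def indicator_def)
    show "AE u in lborel. summable (\<lambda>n. norm (indicator {0<..} u *\<^sub>R f n u))"
      unfolding nf using geo by (auto simp: sums_iff)
    show "summable (\<lambda>n. LINT u|lborel. norm (indicator {0<..} u *\<^sub>R f n u))"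
      unfolding nf val by (rule summ)
  qed (rule int)
  hence "(\<lambda>n. inverse ((x + 1/2 + real n)\<^sup>2)) sums laplace (\<lambda>u. u / (2 * sinh (u / 2))) x"
    unfolding val using geo by (simp add: sums_iff laplace_def set_lebesgue_integral_def)
  moreover have "(\<lambda>n. inverse ((x + 1/2 + real n)\<^sup>2)) sums Polygamma 1 (x + 1/2)"
    using Polygamma_LIMSEQ[of "x + 1/2" 1] assms by (simp add: numeral_2_eq_2)
  ultimately show ?thesis by (rule sums_unique2)
qed

lemma laplace_power2_binet_kernel:
  assumes "x > 0"
  shows "laplace (\<lambda>u. u * (u * binet_kernel u)) x = 1 / x - Polygamma 1 (x + 1/2)"
proof -
  have i1: "set_integrable lborel {0<..} (\<lambda>u. exp (- (u * x)) * 1)"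
    by (rule laplace_integrable[OF assms, of _ 1]) auto
  have i2: "set_integrable lborel {0<..} (\<lambda>u. exp (- (u * x)) * (u / (2 * sinh (u / 2))))"
  proof (rule laplace_integrable[OF assms, of _ 2])
    show "\<bar>u / (2 * sinh (u / 2))\<bar> \<le> 2 * (1 + u\<^sup>2)" if "u > 0" for u :: real
    proof -
      have "\<bar>u / (2 * sinh (u / 2))\<bar> \<le> 2"
        using half_csch_bounds[OF that] by (simp only: abs_of_pos)
      also have "2 \<le> 2 * (1 + u\<^sup>2)" by simp
      finally show ?thesis .
    qed
    have [measurable]: "(\<lambda>u::real. sinh (u / 2)) \<in> borel_measurable borel"
      by (intro borel_measurable_continuous_onI continuous_intros) auto
    show "(\<lambda>u::real. u / (2 * sinh (u / 2))) \<in> borel_measurable borel" by measurable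
  qed
  have "laplace (\<lambda>u. u * (u * binet_kernel u)) x = 
      (LINT u:{0<..}|lborel. exp (- (u * x)) * 1 - exp (- (u * x)) * (u / (2 * sinh (u / 2))))"
    unfolding laplace_def
  proof (intro set_lebesgue_integral_cong allI impI)
    fix u :: real assume "u \<in> {0<..}"
    hence "u * (u * binet_kernel u) = 1 - u / (2 * sinh (u / 2))"
      using power2_binet_kernel[of u] by (simp add: power2_eq_square mult.assoc)
    thus "exp (- (u * x)) * (u * (u * binet_kernel u)) = exp (- (u * x)) * 1 - exp (- (u * x)) * (u / (2 * sinh (u / 2)))"
      by (simp only: right_diff_distrib)
  qed simp
  also have "\<dots> = laplace (\<lambda>_. 1) x - laplace (\<lambda>u. u / (2 * sinh (u / 2))) x"
    unfolding laplace_def by (rule set_integral_diff(2)[OF i1 i2])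
  finally show ?thesis by (simp add: laplace_1 laplace_half_csch assms)
qed

section \<open>The integral for real parameters as a Laplace integral\<close>

lemma set_integral_Ioi_scale:
  fixes f :: "real \<Rightarrow> 'a :: {banach, second_countable_topology}"
  assumes "c > 0"
  shows "set_integrable lborel {0<..} (\<lambda>t. f (c * t)) \<longleftrightarrow> set_integrable lborel {0<..} f"
    and "(LINT u:{0<..}|lborel. f u) = c *\<^sub>R (LINT t:{0<..}|lborel. f (c * t))"
proof -
  have ind: "(\<lambda>t. indicator {0<..} (0 + c * t) *\<^sub>R f (0 + c * t)) = (\<lambda>t. indicator {0<..} t *\<^sub>R f (c * t))"
    using assms by (auto simp: indicator_def zero_less_mult_iff)
  show "set_integrable lborel {0<..} (\<lambda>t. f (c * t)) \<longleftrightarrow> set_integrable lborel {0<..} f"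
    unfolding set_integrable_def
    using lborel_integrable_real_affine_iff[of c "\<lambda>t. indicator {0<..} t *\<^sub>R f t" 0] assms
    unfolding ind by simp
  show "(LINT u:{0<..}|lborel. f u) = c *\<^sub>R (LINT t:{0<..}|lborel. f (c * t))"
    unfolding set_lebesgue_integral_def
    using lborel_integral_real_affine[of c "\<lambda>t. indicator {0<..} t *\<^sub>R f t" 0] assms
    unfolding ind by simp
qed

lemma set_integrable_Ioi_cauchy: "set_integrable lborel {0<..} (\<lambda>t::real. 1 / (1 + t\<^sup>2))"
  using integrable_I0i_1_div_plus_square by (simp only: interval_lebesgue_integral_0_infty)

lemma set_integral_Ioi_cauchy: "(LINT t:{0<..}|lborel. 1 / (1 + t\<^sup>2)) = pi / 2"
  using LBINT_I0i_1_div_plus_square by (simp only: interval_lebesgue_integral_0_infty)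

lemma ln_one_plus_sums:
  fixes q :: real
  assumes "0 < q" "q < 1"
  shows "(\<lambda>n. (-1)^n * (q ^ Suc n / real (Suc n))) sums ln (1 + q)"
    and "summable (\<lambda>n. q ^ Suc n / real (Suc n))"
proof -
  have geo: "summable (\<lambda>n. q ^ n)" using assms by (intro summable_geometric) auto
  have le: "q ^ Suc n / real (Suc n) \<le> q ^ n" for n
  proof -
    have "q ^ Suc n / real (Suc n) \<le> q ^ Suc n / 1" using assms by (intro divide_left_mono) auto
    also have "\<dots> \<le> q ^ n" using assms mult_right_mono[of q 1 "q^n"] by simp
    finally show ?thesis .
  qed
  show s: "summable (\<lambda>n. q ^ Suc n / real (Suc n))"
  proof (rule summable_comparison_test'[OF geo, of 0])
    show "norm (q ^ Suc n / real (Suc n)) \<le> q ^ n" for n using le[of n] assms by simp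
  qed
  have "summable (\<lambda>n. (-1)^n * (q ^ Suc n / real (Suc n)))"
  proof (rule summable_comparison_test'[OF geo, of 0])
    show "norm ((-1)^n * (q ^ Suc n / real (Suc n))) \<le> q ^ n" for n 
    proof -
      have "norm ((-1)^n * (q ^ Suc n / real (Suc n))) = q ^ Suc n / real (Suc n)"
        unfolding norm_mult norm_power using assms by simp
      thus ?thesis using le[of n] by simp
    qed
  qed
  moreover have "ln (1 + q) = (\<Sum>n. (-1)^n * (q ^ Suc n / real (Suc n)))"
    using ln_series[of "1 + q"] assms by simp
  ultimately show "(\<lambda>n. (-1)^n * (q ^ Suc n / real (Suc n))) sums ln (1 + q)"
    by (simp add: sums_iff)
qed

text \<open>The form of Fubini's theorem in which an alternating series of nonnegative functions may be
  integrated term by term, because the integrals of the absolute values are summable.\<close>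

lemma sums_signed_set_integral:
  fixes g :: "nat \<Rightarrow> real \<Rightarrow> real"
  assumes int: "\<And>n. set_integrable lborel {0<..} (g n)"
    and nonneg: "\<And>n u. u > 0 \<Longrightarrow> 0 \<le> g n u"
    and summ: "\<And>u. u > 0 \<Longrightarrow> summable (\<lambda>n. g n u)"
    and summ_int: "summable (\<lambda>n. LINT u:{0<..}|lborel. g n u)"
    and sums: "\<And>u. u > 0 \<Longrightarrow> (\<lambda>n. (-1)^n * g n u) sums S u"
  shows "set_integrable lborel {0<..} S"
    and "(\<lambda>n. (-1)^n * (LINT u:{0<..}|lborel. g n u)) sums (LINT u:{0<..}|lborel. S u)"
proof -
  let ?f = "\<lambda>n u. indicator {0<..} u *\<^sub>R ((-1)^n * g n u)"
  have S: "(\<Sum>n. ?f n u) = indicator {0<..} u *\<^sub>R S u" for u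
    using sums[of u] by (cases "u > 0") (auto simp: sums_iff)
  have nf: "norm (?f n u) = indicator {0<..} u *\<^sub>R g n u" for n u
    using nonneg[of u n] by (auto simp: indicator_def abs_mult)
  have 1: "integrable lborel (?f n)" for n
    using set_integrable_mult_right[OF int[of n], of "(-1)^n"] unfolding set_integrable_def .
  have 2: "AE u in lborel. summable (\<lambda>n. norm (?f n u))"
  proof (rule AE_I2)
    fix u :: real
    show "summable (\<lambda>n. norm (?f n u))" unfolding nf using summ[of u] by (cases "u > 0") auto
  qed
  have 3: "summable (\<lambda>n. LINT u|lborel. norm (?f n u))"
    unfolding nf using summ_int by (simp only: set_lebesgue_integral_def)
  show "set_integrable lborel {0<..} S"
    using integrable_suminf[OF 1 2 3] unfolding S set_integrable_def .
  have "(\<lambda>n. LINT u:{0<..}|lborel. (-1)^n * g n u) sums (LINT u:{0<..}|lborel. S u)"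
    using sums_integral[OF 1 2 3] unfolding S set_lebesgue_integral_def .
  thus "(\<lambda>n. (-1)^n * (LINT u:{0<..}|lborel. g n u)) sums (LINT u:{0<..}|lborel. S u)"
    by (simp only: set_integral_mult_right)
qed

text \<open>Both sides are the same alternating series. On the left, expand \<open>ln (1 + q)\<close> with
  \<open>q = exp (- 2 \<pi> x t)\<close>; on the right, expand the kernel. The \<open>n\<close>-th terms agree after the substitution
  \<open>u = 2 \<pi> (n + 1) t\<close>, which exchanges the decay rate of the exponential with the pole of the
  rational factor. For real \<open>x\<close> this is a mere scaling; for complex \<open>x\<close> it would rotate the path of integration.\<close>

lemma log_integral_eq_laplace:
  fixes x :: real
  assumes "x > 0"
  defines "L \<equiv> \<lambda>t. ln (1 + exp (- (2 * pi * x * t))) / (1 + t\<^sup>2)"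
  shows "set_integrable lborel {0<..} L"
    and "(LINT t:{0<..}|lborel. L t) = pi * laplace binet_kernel x"
proof -
  define c where "c = (\<lambda>n. 2 * pi * real (Suc n))"
  define p where "p = (\<lambda>n u. exp (- (u * x)) * (2 * pi / (u\<^sup>2 + (c n)\<^sup>2)))"
  define q where "q = (\<lambda>t. exp (- (2 * pi * x * t)))"
  have c: "c n > 0" for n by (simp add: c_def)
  have c2: "(c n)\<^sup>2 = 4 * pi\<^sup>2 * real (Suc n) ^ 2" for n by (simp add: c_def power_mult_distrib)
  have k: "0 \<le> 2 * pi / (u\<^sup>2 + (c n)\<^sup>2)" "2 * pi / (u\<^sup>2 + (c n)\<^sup>2) \<le> 2 * pi * (1 / real (Suc n) ^ 2)" for n u
    using norm_binet_kernel_term_le[of n u] unfolding c2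
    by (simp_all add: abs_mult divide_inverse)
  have ip: "set_integrable lborel {0<..} (p n)" for n
    unfolding p_def
  proof (rule laplace_integrable[OF assms(1), of _ "2 * pi * (1 / real (Suc n) ^ 2)"])
    show "\<bar>2 * pi / (u\<^sup>2 + (c n)\<^sup>2)\<bar> \<le> 2 * pi * (1 / real (Suc n) ^ 2) * (1 + u\<^sup>2)" for u
    proof -
      have "2 * pi * (1 / real (Suc n) ^ 2) * 1 \<le> 2 * pi * (1 / real (Suc n) ^ 2) * (1 + u\<^sup>2)"
        by (intro mult_left_mono) auto
      thus ?thesis using k[of u n] by linarith
    qed
  qed simp
  have pos: "0 \<le> p n u" for n u using k(1)[of u n] by (simp add: p_def)
  have ple: "p n u \<le> exp (- (u * x)) * (2 * pi) * (1 / real (Suc n) ^ 2)" for n u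
    using mult_left_mono[OF k(2)[of u n], of "exp (- (u * x))"] by (simp only: p_def mult.assoc) simp
  have sp: "summable (\<lambda>n. p n u)" for u
  proof (rule summable_comparison_test'[OF summable_mult[OF summable_inverse_Suc_power2], of 0])
    show "norm (p n u) \<le> exp (- (u * x)) * (2 * pi) * (1 / real (Suc n) ^ 2)" for n
      using ple pos by simp
  qed
  have sip: "summable (\<lambda>n. LINT u:{0<..}|lborel. p n u)"
  proof (rule summable_comparison_test'[OF summable_mult[OF summable_inverse_Suc_power2], of 0])
    fix n
    have i1: "set_integrable lborel {0<..} (\<lambda>u. exp (- (u * x)) * 1)"
      by (rule laplace_integrable[OF assms(1), of _ 1]) auto
    have "0 \<le> (LINT u:{0<..}|lborel. p n u)"
      unfolding set_lebesgue_integral_def using pos by (intro integral_nonneg_AE AE_I2) auto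
    moreover have "(LINT u:{0<..}|lborel. p n u) \<le> (LINT u:{0<..}|lborel. (2 * pi * (1 / real (Suc n) ^ 2)) * (exp (- (u * x)) * 1))"
      using ple[of n] by (intro set_integral_mono ip set_integrable_mult_right i1) (simp add: mult_ac)
    moreover have "\<dots> = 2 * pi * (1 / real (Suc n) ^ 2) * (1 / x)"
      using laplace_1[OF assms(1)] unfolding set_integral_mult_right laplace_def by (simp only:)
    ultimately show "norm (LINT u:{0<..}|lborel. p n u) \<le> (2 * pi * (1 / x)) * (1 / real (Suc n) ^ 2)"
      by (simp only: real_norm_def abs_of_nonneg mult_ac)
  qed
  have "(\<lambda>n. (-1)^n * (LINT u:{0<..}|lborel. p n u)) sums (LINT u:{0<..}|lborel. pi * (exp (- (u * x)) * binet_kernel u))"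
  proof (rule sums_signed_set_integral(2)[OF ip pos sp sip])
    fix u :: real
    have "(\<lambda>n. pi * exp (- (u * x)) * (2 * ((-1)^n / (u\<^sup>2 + 4 * pi\<^sup>2 * real (Suc n) ^ 2)))) sums (pi * exp (- (u * x)) * binet_kernel u)"
      by (intro sums_mult binet_kernel_sums)
    thus "(\<lambda>n. (-1)^n * p n u) sums (pi * (exp (- (u * x)) * binet_kernel u))"
      unfolding p_def c2 by (simp only: mult_ac times_divide_eq_right times_divide_eq_left)
  qed
  hence A: "(\<lambda>n. (-1)^n * (LINT u:{0<..}|lborel. p n u)) sums (pi * laplace binet_kernel x)"
    unfolding laplace_def by (simp only: set_integral_mult_right)
  \<comment> \<open>\<open>r n\<close> is the \<open>n\<close>-th term \<open>p n\<close> on the kernel side after the substitution \<open>u = c n * t\<close>.\<close>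
  define r where "r = (\<lambda>n t. c n * p n (c n * t))"
  have r: "r n t = q t ^ Suc n / real (Suc n) / (1 + t\<^sup>2)" for n t
  proof -
    have q': "exp (- (c n * t * x)) = q t ^ Suc n"
      unfolding q_def c_def exp_of_nat_mult[symmetric] by (simp add: algebra_simps)
    have "1 + t\<^sup>2 > 0" by (intro add_pos_nonneg) auto
    have "r n t = q t ^ Suc n * (2 * pi * c n / ((c n)\<^sup>2 * (t\<^sup>2 + 1)))"
      unfolding r_def p_def q' by (simp add: power_mult_distrib algebra_simps)
    also have "2 * pi * c n / ((c n)\<^sup>2 * (t\<^sup>2 + 1)) = 2 * pi / c n / (1 + t\<^sup>2)"
      using c[of n] by (simp add: power2_eq_square add.commute)
    also have "2 * pi / c n = 1 / real (Suc n)" by (simp add: c_def)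
    finally show ?thesis by simp
  qed
  have lint: "(LINT t:{0<..}|lborel. r n t) = (LINT u:{0<..}|lborel. p n u)" for n
    using set_integral_Ioi_scale(2)[OF c[of n], of "p n"] unfolding r_def by simp
  have ir: "set_integrable lborel {0<..} (r n)" for n
    unfolding r_def using ip[of n] set_integral_Ioi_scale(1)[OF c[of n], of "p n"] by simp
  have q01: "0 < q t" "q t < 1" if "t > 0" for t
    using that assms(1) by (simp_all add: q_def)
  have B: "set_integrable lborel {0<..} L" "(\<lambda>n. (-1)^n * (LINT t:{0<..}|lborel. r n t)) sums (LINT t:{0<..}|lborel. L t)"
  proof -
    have nn: "0 \<le> r n t" for n t unfolding r_def using pos c[of n] by simp
    have s1: "summable (\<lambda>n. r n t)" if "t > 0" for t
      unfolding r using q01[OF that] by (intro summable_divide ln_one_plus_sums(2))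
    have s2: "summable (\<lambda>n. LINT t:{0<..}|lborel. r n t)" unfolding lint by (rule sip)
    have s3: "(\<lambda>n. (-1)^n * r n t) sums L t" if "t > 0" for t
    proof -
      have "(\<lambda>n. (-1)^n * (q t ^ Suc n / real (Suc n)) / (1 + t\<^sup>2)) sums (ln (1 + q t) / (1 + t\<^sup>2))"
        using q01[OF that] by (intro sums_divide ln_one_plus_sums(1))
      thus ?thesis unfolding L_def r q_def by (simp only: times_divide_eq_right)
    qed
    show "set_integrable lborel {0<..} L" 
      by (rule sums_signed_set_integral(1)[OF ir nn s1 s2 s3])
    show "(\<lambda>n. (-1)^n * (LINT t:{0<..}|lborel. r n t)) sums (LINT t:{0<..}|lborel. L t)"
      by (rule sums_signed_set_integral(2)[OF ir nn s1 s2 s3])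
  qed
  show "set_integrable lborel {0<..} L" by (rule B(1))
  show "(LINT t:{0<..}|lborel. L t) = pi * laplace binet_kernel x"
    using B(2) A unfolding lint by (rule sums_unique2)
qed

text \<open>The limit as \<open>x \<longlongrightarrow> 0\<close> is easiest on the other side of \<open>log_integral_eq_laplace\<close>, where
  \<open>ln (1 + exp (- 2 \<pi> x t))\<close> increases to \<open>ln 2\<close> under the integrable weight \<open>1 / (1 + t\<^sup>2)\<close>.\<close>

lemma laplace_binet_kernel_tendsto_0: "(\<lambda>n. laplace binet_kernel (1 / real (Suc n))) \<longlonglongrightarrow> ln 2 / 2"
proof -
  let ?L = "\<lambda>x t. ln (1 + exp (- (2 * pi * x * t))) / (1 + t\<^sup>2)"
  have "(\<lambda>n. LINT t|lborel. indicator {0<..} t *\<^sub>R ?L (1 / real (Suc n)) t) 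
    \<longlonglongrightarrow> (LINT t|lborel. indicator {0<..} t *\<^sub>R (ln 2 * (1 / (1 + t\<^sup>2))))"
  proof (rule integral_dominated_convergence)
    show "integrable lborel (\<lambda>t. indicator {0<..} t *\<^sub>R (ln 2 * (1 / (1 + t\<^sup>2))) :: real)"
      using set_integrable_mult_right[OF set_integrable_Ioi_cauchy, of "ln 2"] unfolding set_integrable_def .
    show "AE t in lborel. (\<lambda>n. indicator {0<..} t *\<^sub>R ?L (1 / real (Suc n)) t) \<longlonglongrightarrow> indicator {0<..} t *\<^sub>R (ln 2 * (1 / (1 + t\<^sup>2)))"
    proof (rule AE_I2)
      fix t :: real
      have "(\<lambda>n. 1 / real (Suc n)) \<longlonglongrightarrow> 0" by real_asymp
      hence "(\<lambda>n. ?L (1 / real (Suc n)) t) \<longlonglongrightarrow> ln (1 + exp (- (2 * pi * 0 * t))) / (1 + t\<^sup>2)"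
        by (intro tendsto_intros) (auto simp: add_nonneg_eq_0_iff)
      thus "(\<lambda>n. indicator {0<..} t *\<^sub>R ?L (1 / real (Suc n)) t) \<longlonglongrightarrow> indicator {0<..} t *\<^sub>R (ln 2 * (1 / (1 + t\<^sup>2)))"
        by (intro tendsto_scaleR tendsto_const) simp
    qed
    show "AE t in lborel. norm (indicator {0<..} t *\<^sub>R ?L (1 / real (Suc n)) t) \<le> indicator {0<..} t *\<^sub>R (ln 2 * (1 / (1 + t\<^sup>2)))" for n
    proof (rule AE_I2)
      fix t :: real
      show "norm (indicator {0<..} t *\<^sub>R ?L (1 / real (Suc n)) t) \<le> indicator {0<..} t *\<^sub>R (ln 2 * (1 / (1 + t\<^sup>2)))"
      proof (cases "t > 0")
        case True
        have "exp (- (2 * pi * (1 / real (Suc n)) * t)) \<le> 1" using True by simp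
        hence "ln (1 + exp (- (2 * pi * (1 / real (Suc n)) * t))) \<le> ln 2" 
          by (subst ln_le_cancel_iff) (auto intro: add_pos_pos)
        moreover have "0 \<le> ln (1 + exp (- (2 * pi * (1 / real (Suc n)) * t)))" by (intro ln_ge_zero) simp
        moreover have "1 + t\<^sup>2 > 0" by (intro add_pos_nonneg) auto
        ultimately have "0 \<le> ?L (1 / real (Suc n)) t" "?L (1 / real (Suc n)) t \<le> ln 2 / (1 + t\<^sup>2)"
          by (auto intro: divide_right_mono)
        thus ?thesis using True by (simp only: real_norm_def indicator_simps(1) greaterThan_iff) simp
      qed simp
    qed
  qed measurable
  hence "(\<lambda>n. LINT t:{0<..}|lborel. ?L (1 / real (Suc n)) t) \<longlonglongrightarrow> (LINT t:{0<..}|lborel. ln 2 * (1 / (1 + t\<^sup>2)))"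
    unfolding set_lebesgue_integral_def .
  moreover have "(LINT t:{0<..}|lborel. ?L (1 / real (Suc n)) t) = pi * laplace binet_kernel (1 / real (Suc n))" for n
    by (rule log_integral_eq_laplace(2)) simp
  moreover have "(LINT t:{0<..}|lborel. ln 2 * (1 / (1 + t\<^sup>2))) = ln 2 * (pi / 2)"
    unfolding set_integral_mult_right set_integral_Ioi_cauchy ..
  ultimately have "(\<lambda>n. pi * laplace binet_kernel (1 / real (Suc n))) \<longlonglongrightarrow> ln 2 * (pi / 2)"
    by (simp only:)
  hence "(\<lambda>n. pi * laplace binet_kernel (1 / real (Suc n)) / pi) \<longlonglongrightarrow> ln 2 * (pi / 2) / pi"
    by (intro tendsto_divide tendsto_const) auto
  thus ?thesis by simp
qed

section \<open>The Binet integral for the logarithm of the Gamma function\<close>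

lemma const_on_Ioi_if_DERIV_0:
  fixes f :: "real \<Rightarrow> real"
  assumes "\<And>x. x > 0 \<Longrightarrow> (f has_real_derivative 0) (at x)" "x > 0" "y > 0"
  shows "f x = f y"
proof -
  obtain c where "\<And>z. z \<in> {0<..} \<Longrightarrow> f z = c"
    using has_field_derivative_zero_constant[of "{0<..}" f] assms(1)
    by (metis convex_real_interval(3) greaterThan_iff has_field_derivative_at_within)
  thus ?thesis using assms(2,3) by simp
qed

lemma laplace_bounded_le:
  fixes h :: "real \<Rightarrow> real"
  assumes "x > 0" "h \<in> borel_measurable borel" "\<And>u. u > 0 \<Longrightarrow> \<bar>h u\<bar> \<le> C"
  shows "\<bar>laplace h x\<bar> \<le> C / x"
proof -
  have C0: "C \<ge> 0" using assms(3)[of 1] by simp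
  have i: "set_integrable lborel {0<..} (\<lambda>u. exp (- (u * x)) * h u)"
  proof (rule laplace_integrable[where C = C])
    show "\<bar>h u\<bar> \<le> C * (1 + u\<^sup>2)" if "u > 0" for u
      using assms(3)[OF that] mult_left_mono[OF _ C0, of 1 "1 + u^2"] by simp
  qed (use assms in auto)
  have i1: "set_integrable lborel {0<..} (\<lambda>u. exp (- (u * x)) * 1)"
    by (rule laplace_integrable[OF assms(1), of _ 1]) auto
  have "\<bar>laplace h x\<bar> \<le> (LINT u:{0<..}|lborel. norm (exp (- (u * x)) * h u))"
    using set_integral_norm_bound[OF i] by (simp only: laplace_def real_norm_def)
  also have "\<dots> \<le> (LINT u:{0<..}|lborel. C * (exp (- (u * x)) * 1))"
  proof (rule set_integral_mono)
    show "set_integrable lborel {0<..} (\<lambda>u. norm (exp (- (u * x)) * h u))"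
      using set_integrable_abs[OF i] by (simp only: real_norm_def)
    show "norm (exp (- (u * x)) * h u) \<le> C * (exp (- (u * x)) * 1)" if "u \<in> {0<..}" for u
      using assms(3)[of u] that by (simp add: abs_mult mult.commute)
  qed (intro set_integrable_mult_right i1)
  also have "\<dots> = C / x"
    using laplace_1[OF assms(1)] unfolding set_integral_mult_right laplace_def by simp
  finally show ?thesis .
qed

text \<open>Both sides have the same derivative by \<open>laplace_power2_binet_kernel\<close>. The constant is found at
  infinity: the left side is \<open>O(1 / x)\<close>, and at the points \<open>x = n + 1/2\<close> the digamma function is a
  harmonic number minus Euler's constant, so the right side tends to 0 there.\<close>

lemma laplace_id_binet_kernel:
  assumes "x > 0"
  shows "laplace (\<lambda>u. u * binet_kernel u) x = Digamma (x + 1/2) - ln x"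
proof -
  obtain C where C: "\<And>u. u > 0 \<Longrightarrow> \<bar>u * binet_kernel u\<bar> \<le> C"
    using binet_kernel_bounded by metis
  define f where "f = (\<lambda>x. laplace (\<lambda>u. u * binet_kernel u) x - (Digamma (x + 1/2) - ln x))"
  have f': "(f has_real_derivative 0) (at x)" if "x > 0" for x
  proof -
    have "(laplace (\<lambda>u. u * binet_kernel u) has_real_derivative - laplace (\<lambda>u. u * (u * binet_kernel u)) x) (at x)"
      by (rule laplace_has_derivative[OF that _ C]) measurable
    moreover have "((\<lambda>x. Digamma (x + 1/2) - ln x) has_real_derivative (Polygamma 1 (x + 1/2) - 1 / x)) (at x)"
    proof -
      have "x + 1/2 \<notin> \<int>\<^sub>\<le>\<^sub>0" using that by (auto elim!: nonpos_Ints_cases)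
      thus ?thesis using that by (auto intro!: derivative_eq_intros)
    qed
    ultimately have "(f has_real_derivative (- laplace (\<lambda>u. u * (u * binet_kernel u)) x - (Polygamma 1 (x + 1/2) - 1 / x))) (at x)"
      unfolding f_def by (rule DERIV_diff)
    thus ?thesis using laplace_power2_binet_kernel[OF that] by simp
  qed
  \<comment> \<open>Along half-integers the argument of the digamma function is an integer.\<close>
  have "(\<lambda>n. f (real n + 1/2)) \<longlonglongrightarrow> 0"
  proof -
    have "(\<lambda>n. laplace (\<lambda>u. u * binet_kernel u) (real n + 1/2)) \<longlonglongrightarrow> 0"
    proof (rule Lim_null_comparison)
      show "\<forall>\<^sub>F n in sequentially. norm (laplace (\<lambda>u. u * binet_kernel u) (real n + 1/2)) \<le> C / (real n + 1/2)"
      proof (rule always_eventually, rule allI)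
        fix n
        have "real n + 1/2 > 0" by simp
        from laplace_bounded_le[OF this _ C] 
        show "norm (laplace (\<lambda>u. u * binet_kernel u) (real n + 1/2)) \<le> C / (real n + 1/2)" by simp
      qed
      show "(\<lambda>n. C / (real n + 1/2)) \<longlonglongrightarrow> 0" by real_asymp
    qed
    moreover have "(\<lambda>n. Digamma (real n + 1/2 + 1/2) - ln (real n + 1/2)) \<longlonglongrightarrow> 0"
    proof -
      have D: "Digamma (real n + 1/2 + 1/2) = harm n - euler_mascheroni" for n
        using Digamma_of_nat[of n, where 'a = real] by (simp add: add.commute)
      have "(\<lambda>n. (harm n - ln (real n)) - euler_mascheroni + (ln (real n) - ln (real n + 1/2))) \<longlonglongrightarrow> euler_mascheroni - euler_mascheroni + (0::real)"
      proof (intro tendsto_intros euler_mascheroni_LIMSEQ)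
        show "(\<lambda>n. ln (real n) - ln (real n + 1/2)) \<longlonglongrightarrow> 0" by real_asymp
      qed
      thus ?thesis unfolding D by (simp add: algebra_simps)
    qed
    ultimately show ?thesis unfolding f_def using tendsto_diff by fastforce
  qed
  moreover have "f (real n + 1/2) = f x" for n
    by (rule const_on_Ioi_if_DERIV_0[OF f']) (use assms in auto)
  ultimately have "f x = 0" by (simp add: LIMSEQ_const_iff)
  thus ?thesis by (simp add: f_def)
qed

text \<open>Binet's first formula, shifted by one half. Both sides have the same derivative, and here the
  constant is found at the origin, where \<open>\<Gamma>(1/2) = \<surd>\<pi>\<close> and the limit of the left side is known; Stirling's
  formula is thereby avoided.\<close>

lemma laplace_binet_kernel:
  assumes "x > 0"
  shows "laplace binet_kernel x = x * ln x - x + ln (2 * pi) / 2 - ln_Gamma (x + 1/2)"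
proof -
  obtain C where C: "\<And>u. \<bar>binet_kernel u\<bar> \<le> C"
    using binet_kernel_bounded by metis
  define R where "R = (\<lambda>x::real. x * ln x - x + ln (2 * pi) / 2 - ln_Gamma (x + 1/2))"
  define f where "f = (\<lambda>x. laplace binet_kernel x - R x)"
  have f': "(f has_real_derivative 0) (at x)" if "x > 0" for x
  proof -
    have "(laplace binet_kernel has_real_derivative - laplace (\<lambda>u. u * binet_kernel u) x) (at x)"
      by (rule laplace_has_derivative[OF that _ C]) measurable
    moreover have "(R has_real_derivative (ln x - Digamma (x + 1/2))) (at x)"
      unfolding R_def using that by (auto intro!: derivative_eq_intros)
    ultimately have "(f has_real_derivative (- laplace (\<lambda>u. u * binet_kernel u) x - (ln x - Digamma (x + 1/2)))) (at x)"
      unfolding f_def by (intro DERIV_diff)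
    thus ?thesis using laplace_id_binet_kernel[OF that] by simp
  qed
  have "(\<lambda>n. f (1 / real (Suc n))) \<longlonglongrightarrow> 0"
  proof -
    have "isCont (\<lambda>x::real. ln_Gamma (x + 1/2)) 0"
      by (rule DERIV_isCont) (auto intro!: derivative_eq_intros)
    hence "((\<lambda>x::real. ln_Gamma (x + 1/2)) \<longlongrightarrow> ln_Gamma (0 + 1/2)) (at 0)" by (simp only: isCont_def)
    moreover have "filterlim (\<lambda>n. 1 / real (Suc n)) (at 0) sequentially" by real_asymp
    ultimately have "(\<lambda>n. ln_Gamma (1 / real (Suc n) + 1/2)) \<longlonglongrightarrow> ln_Gamma (0 + 1/2 :: real)"
      by (rule filterlim_compose)
    moreover have G: "ln_Gamma (0 + 1/2 :: real) = ln pi / 2"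
      by (simp add: ln_Gamma_real_pos Gamma_one_half_real ln_sqrt)
    moreover have "(\<lambda>n. 1 / real (Suc n) * ln (1 / real (Suc n)) - 1 / real (Suc n)) \<longlonglongrightarrow> 0" by real_asymp
    ultimately have "(\<lambda>n. 1 / real (Suc n) * ln (1 / real (Suc n)) - 1 / real (Suc n) + ln (2 * pi) / 2 - ln_Gamma (1 / real (Suc n) + 1/2)) \<longlonglongrightarrow> 0 + ln (2 * pi) / 2 - ln pi / 2"
      unfolding G by (intro tendsto_diff[OF tendsto_add[OF _ tendsto_const]])
    hence "(\<lambda>n. R (1 / real (Suc n))) \<longlonglongrightarrow> ln 2 / 2"
      unfolding R_def by (simp add: ln_mult add_divide_distrib)
    from tendsto_diff[OF laplace_binet_kernel_tendsto_0 this] show ?thesis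
      unfolding f_def by simp
  qed
  moreover have "f (1 / real (Suc n)) = f x" for n
    by (rule const_on_Ioi_if_DERIV_0[OF f']) (use assms in auto)
  ultimately have "f x = 0" by (simp add: LIMSEQ_const_iff)
  thus ?thesis by (simp add: f_def R_def)
qed

section \<open>Holomorphic dependence on the parameter\<close>

text \<open>The required branch of \<open>ln (exp (a t) / cosh (a t)) = ln (2 / (1 + exp (- 2 a t)))\<close>. For
  \<open>Re a > 0\<close> and \<open>t \<ge> 0\<close> the number \<open>1 + exp (- 2 a t)\<close> lies in the right half-plane, so that the
  principal logarithm is analytic there.\<close>

definition ln_exp_sech :: "complex \<Rightarrow> real \<Rightarrow> complex" where
  "ln_exp_sech a t = of_real (ln 2) - Ln (1 + exp (- (2 * a * of_real t)))"

lemma norm_exp_2mult: "norm (exp (- (2 * a * complex_of_real t))) = exp (- (2 * Re a * t))"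
  by simp

lemma Re_one_plus_exp_pos:
  assumes "Re a > 0" "t \<ge> 0"
  shows "Re (1 + exp (- (2 * a * complex_of_real t))) > 0"
proof (cases "t = 0")
  case False
  hence "2 * Re a * t > 0" using assms by simp
  hence "exp (- (2 * Re a * t)) < 1" by simp
  hence "norm (exp (- (2 * a * complex_of_real t))) < 1" by (simp only: norm_exp_2mult)
  hence "\<bar>Re (exp (- (2 * a * complex_of_real t)))\<bar> < 1"
    using abs_Re_le_cmod[of "exp (- (2 * a * complex_of_real t))"] by linarith
  thus ?thesis unfolding plus_complex.simps by simp
qed simp

lemma one_plus_exp_neq_0:
  assumes "Re a > 0" "t \<ge> 0"
  shows "1 + exp (- (2 * a * complex_of_real t)) \<noteq> 0"
  using Re_one_plus_exp_pos[OF assms] by (metis less_irrefl zero_complex.simps(1))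

lemma one_plus_exp_notin_nonpos_Reals:
  assumes "Re a > 0" "t \<ge> 0"
  shows "1 + exp (- (2 * a * complex_of_real t)) \<notin> \<real>\<^sub>\<le>\<^sub>0"
  using Re_one_plus_exp_pos[OF assms] unfolding complex_nonpos_Reals_iff by linarith

lemma ln_branch_exp_sech_eq:
  assumes "t > 0" "Re a > 0"
  shows "ln_branch (\<lambda>z. exp (z * of_real t) * inverse (cosh (z * of_real t))) a = ln_exp_sech a t"
proof (rule ln_branch_eqI[where g = "\<lambda>z. ln_exp_sech z t", OF _ assms(2)])
  show "is_ln_branch (\<lambda>z. exp (z * of_real t) * inverse (cosh (z * of_real t))) (\<lambda>z. ln_exp_sech z t)"
    unfolding is_ln_branch_def
  proof (intro conjI allI impI)
    show "(\<lambda>z. ln_exp_sech z t) analytic_on {z. Re z > 0}"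
      unfolding ln_exp_sech_def using one_plus_exp_notin_nonpos_Reals assms(1)
      by (subst analytic_on_open[OF open_halfspace_Re_gt]) (auto intro!: holomorphic_intros)
  next
    fix z :: complex assume z: "Re z > 0"
    let ?e = "exp (z * of_real t)" and ?w = "exp (- (2 * z * of_real t))"
    have "exp (- (z * of_real t)) = ?e * ?w"
      unfolding exp_add[symmetric] by (simp add: algebra_simps)
    hence "cosh (z * of_real t) = ?e * (1 + ?w) / 2"
      by (simp add: cosh_def scaleR_conv_of_real distrib_left)
    moreover have "?e \<noteq> 0" "1 + ?w \<noteq> 0" using one_plus_exp_neq_0[OF z] assms(1) by auto
    hence "?e * inverse (?e * (1 + ?w) / 2) = 2 / (1 + ?w)" by (simp only: inverse_eq_divide) simp
    ultimately have "?e * inverse (cosh (z * of_real t)) = 2 / (1 + ?w)" by (simp only:)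
    moreover have "exp (ln_exp_sech z t) = 2 / (1 + ?w)"
      unfolding ln_exp_sech_def exp_diff exp_of_real using \<open>1 + ?w \<noteq> 0\<close> by simp
    ultimately show "exp (ln_exp_sech z t) = ?e * inverse (cosh (z * of_real t))" by simp
  next
    fix x :: real
    have "1 + exp (- (2 * x * t)) > 0" by (simp add: add_pos_pos)
    hence "Ln (of_real (1 + exp (- (2 * x * t)))) = of_real (ln (1 + exp (- (2 * x * t))))"
      by (rule Ln_of_real)
    thus "ln_exp_sech (of_real x) t \<in> \<real>"
      unfolding ln_exp_sech_def by (simp flip: exp_of_real)
  qed
qed

lemma ln_exp_sech_of_real:
  "ln_exp_sech (of_real x) t = of_real (ln 2 - ln (1 + exp (- (2 * x * t))))"
proof -
  have "1 + exp (- (2 * x * t)) > 0" by (simp add: add_pos_pos)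
  hence "Ln (of_real (1 + exp (- (2 * x * t)))) = of_real (ln (1 + exp (- (2 * x * t))))"
    by (rule Ln_of_real)
  thus ?thesis unfolding ln_exp_sech_def by (simp flip: exp_of_real)
qed

lemma continuous_on_ln_exp_sech:
  assumes "Re a > 0"
  shows "continuous_on {0..} (ln_exp_sech a)"
  unfolding ln_exp_sech_def using one_plus_exp_notin_nonpos_Reals[OF assms]
  by (intro continuous_intros) auto

text \<open>The threshold \<open>1 / \<delta>\<close> makes the exponent at least 2 in absolute value, and \<open>exp 2 > 2\<close>.\<close>

lemma norm_exp_2mult_small:
  assumes "\<delta> > 0" "\<delta> \<le> Re a" "t \<ge> 1 / \<delta>"
  shows "norm (exp (- (2 * a * complex_of_real t))) < 1 / 2"
proof -
  have "t \<ge> 0" using assms(1,3) by (meson order_trans less_imp_le zero_le_divide_1_iff)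
  hence "1 / \<delta> * \<delta> \<le> t * Re a" using assms by (intro mult_mono) auto
  hence "1 \<le> Re a * t" using assms(1) by (simp add: mult.commute)
  hence "1 + 1 < exp (2 * Re a * t)"
    using exp_ge_add_one_self[of "2 * Re a * t"] by linarith
  hence "inverse (exp (2 * Re a * t)) < inverse 2" by (intro less_imp_inverse_less) auto
  thus ?thesis unfolding norm_exp_2mult unfolding exp_minus by simp
qed

text \<open>The bound is uniform on \<open>Re a \<ge> \<delta>\<close>, which is what locally uniform convergence in \<open>a\<close> requires.\<close>

lemma norm_ln_exp_sech_le_2:
  assumes "\<delta> > 0" "\<delta> \<le> Re a" "t \<ge> 1 / \<delta>"
  shows "norm (ln_exp_sech a t) \<le> 2"
proof -
  let ?w = "exp (- (2 * a * complex_of_real t))"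
  have w: "norm ?w < 1 / 2" by (rule norm_exp_2mult_small[OF assms])
  have "norm (ln_exp_sech a t) \<le> norm (complex_of_real (ln 2)) + norm (Ln (1 + ?w))"
    unfolding ln_exp_sech_def by (rule norm_triangle_ineq4)
  moreover have "norm (complex_of_real (ln 2)) \<le> 1"
    using ln_le_minus_one[of "2::real"] by (simp add: norm_of_real)
  ultimately show ?thesis using norm_Ln_le[OF w] w by linarith
qed

lemma bounded_on_Ici_if_eventually_bounded:
  fixes f :: "real \<Rightarrow> complex"
  assumes "continuous_on {0..} f" "\<And>t. t \<ge> T \<Longrightarrow> norm (f t) \<le> B"
  obtains C where "C > 0" "\<And>t. t \<ge> 0 \<Longrightarrow> norm (f t) \<le> C"
proof -
  have "compact (f ` {0..T})"
    by (rule compact_continuous_image[OF continuous_on_subset[OF assms(1)]]) auto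
  then obtain M where M: "\<And>t. t \<in> {0..T} \<Longrightarrow> norm (f t) \<le> M"
    using compact_imp_bounded bounded_iff by (metis image_eqI)
  show ?thesis
  proof (rule that[of "max (max M B) 1"])
    show "norm (f t) \<le> max (max M B) 1" if "t \<ge> 0" for t
      using M[of t] assms(2)[of t] that by (cases "t \<le> T") auto
  qed auto
qed

lemma ln_exp_sech_bounded:
  assumes "Re a > 0"
  obtains C where "C > 0" "\<And>t. t \<ge> 0 \<Longrightarrow> norm (ln_exp_sech a t) \<le> C"
  using bounded_on_Ici_if_eventually_bounded[OF continuous_on_ln_exp_sech[OF assms] norm_ln_exp_sech_le_2[OF assms order_refl]]
  by blast

lemma one_plus_power2_neq_0: "1 + t\<^sup>2 \<noteq> (0 :: real)"
  using zero_le_power2[of t] by linarith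

lemma set_integrable_ln_exp_sech:
  assumes "Re a > 0"
  shows "set_integrable lborel {0<..} (\<lambda>t. ln_exp_sech a t / of_real (1 + t\<^sup>2))"
proof -
  obtain C where C: "C > 0" "\<And>t. t \<ge> 0 \<Longrightarrow> norm (ln_exp_sech a t) \<le> C"
    using ln_exp_sech_bounded[OF assms] by blast
  show ?thesis
  proof (rule set_integrable_bound)
    show "set_integrable lborel {0<..} (\<lambda>t. C * (1 / (1 + t\<^sup>2)))"
      by (intro set_integrable_mult_right set_integrable_Ioi_cauchy)
    have "continuous_on {0<..} (ln_exp_sech a)"
      by (rule continuous_on_subset[OF continuous_on_ln_exp_sech[OF assms]]) auto
    hence "continuous_on {0<..} (\<lambda>t. ln_exp_sech a t / of_real (1 + t\<^sup>2))"
      using one_plus_power2_neq_0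
      by (intro continuous_intros) (auto simp del: of_real_add)
    thus "set_borel_measurable lborel {0<..} (\<lambda>t. ln_exp_sech a t / of_real (1 + t\<^sup>2))"
      unfolding set_borel_measurable_def measurable_lborel2
      by (intro borel_measurable_continuous_on_indicator) auto
    show "AE t in lborel. t \<in> {0<..} \<longrightarrow> norm (ln_exp_sech a t / of_real (1 + t\<^sup>2)) \<le> norm (C * (1 / (1 + t\<^sup>2)))"
    proof (rule AE_I2, rule impI)
      fix t :: real assume "t \<in> {0<..}"
      have "1 + t\<^sup>2 > 0" by (intro add_pos_nonneg) auto
      hence "norm (ln_exp_sech a t / of_real (1 + t\<^sup>2)) = norm (ln_exp_sech a t) / (1 + t\<^sup>2)"
        unfolding norm_divide norm_of_real by simp
      also have "\<dots> \<le> C / (1 + t\<^sup>2)"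
        using C(2)[of t] \<open>t \<in> {0<..}\<close> \<open>1 + t\<^sup>2 > 0\<close> by (intro divide_right_mono) auto
      also have "\<dots> = norm (C * (1 / (1 + t\<^sup>2)))"
        using C(1) \<open>1 + t\<^sup>2 > 0\<close> by simp
      finally show "norm (ln_exp_sech a t / of_real (1 + t\<^sup>2)) \<le> norm (C * (1 / (1 + t\<^sup>2)))" .
    qed
  qed
qed

lemma cauchy_tail_tendsto_0: "(\<lambda>n. LINT t:{real n<..}|lborel. 2 * (1 / (1 + t\<^sup>2))) \<longlonglongrightarrow> 0"
proof -
  have "(\<lambda>n. LINT t|lborel. indicator {real n<..} t *\<^sub>R (2 * (1 / (1 + t\<^sup>2)))) \<longlonglongrightarrow> (LINT t::real|lborel. 0 :: real)"
  proof (rule integral_dominated_convergence)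
    show "integrable lborel (\<lambda>t::real. indicator {0<..} t *\<^sub>R (2 * (1 / (1 + t\<^sup>2))))"
      using set_integrable_mult_right[OF set_integrable_Ioi_cauchy, of 2] unfolding set_integrable_def .
    show "AE t in lborel. (\<lambda>n. indicator {real n<..} t *\<^sub>R (2 * (1 / (1 + t\<^sup>2)))) \<longlonglongrightarrow> (0::real)"
    proof (rule AE_I2)
      fix t :: real
      obtain N where "t \<le> real N" using real_arch_simple by blast
      hence "\<forall>\<^sub>F n in sequentially. indicator {real n<..} t *\<^sub>R (2 * (1 / (1 + t\<^sup>2))) = (0::real)"
        by (intro eventually_sequentiallyI[of N]) (auto simp: indicator_def)
      thus "(\<lambda>n. indicator {real n<..} t *\<^sub>R (2 * (1 / (1 + t\<^sup>2)))) \<longlonglongrightarrow> (0::real)"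
        by (rule tendsto_eventually)
    qed
    show "AE t in lborel. norm (indicator {real n<..} t *\<^sub>R (2 * (1 / (1 + t\<^sup>2)))) \<le> indicator {0<..} t *\<^sub>R (2 * (1 / (1 + t\<^sup>2)))" for n
      by (intro AE_I2) (auto simp: indicator_def)
  qed measurable
  thus ?thesis unfolding set_lebesgue_integral_def by simp
qed

lemma holomorphic_on_ln_exp_sech_integral_Icc:
  "(\<lambda>a. LINT t:{0..real n}|lborel. ln_exp_sech a t / of_real (1 + t\<^sup>2)) holomorphic_on {a. Re a > 0}"
proof -
  have cont: "continuous_on {0..real n} (\<lambda>t. ln_exp_sech a t / of_real (1 + t\<^sup>2))" if "Re a > 0" for a
    using continuous_on_subset[OF continuous_on_ln_exp_sech[OF that], of "{0..real n}"] one_plus_power2_neq_0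
    by (intro continuous_intros) (auto simp del: of_real_add)
  have "(\<lambda>a. integral (cbox 0 (real n)) (\<lambda>t. ln_exp_sech a t / of_real (1 + t\<^sup>2))) holomorphic_on {a. Re a > 0}"
  proof (rule leibniz_rule_holomorphic[where fx = "\<lambda>a t. (2 * of_real t * exp (- (2 * a * of_real t)) / (1 + exp (- (2 * a * of_real t)))) / of_real (1 + t\<^sup>2)"])
    fix a :: complex and t :: real
    assume "a \<in> {a. Re a > 0}" "t \<in> cbox 0 (real n)"
    hence "1 + exp (- (2 * a * of_real t)) \<notin> \<real>\<^sub>\<le>\<^sub>0" using one_plus_exp_notin_nonpos_Reals by auto
    hence "((\<lambda>a. ln_exp_sech a t) has_field_derivative (2 * of_real t * exp (- (2 * a * of_real t)) / (1 + exp (- (2 * a * of_real t))))) (at a within {a. Re a > 0})"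
      unfolding ln_exp_sech_def by (auto intro!: derivative_eq_intros simp: divide_inverse mult_ac)
    thus "((\<lambda>a. ln_exp_sech a t / of_real (1 + t\<^sup>2)) has_field_derivative
        (2 * of_real t * exp (- (2 * a * of_real t)) / (1 + exp (- (2 * a * of_real t)))) / of_real (1 + t\<^sup>2)) (at a within {a. Re a > 0})"
      by (rule DERIV_cdivide)
  next
    fix a assume "a \<in> {a. Re a > 0}"
    thus "(\<lambda>t. ln_exp_sech a t / of_real (1 + t\<^sup>2)) integrable_on cbox 0 (real n)"
      using cont by (intro integrable_continuous) auto
  next
    show "continuous_on ({a. Re a > 0} \<times> cbox 0 (real n)) (\<lambda>(a, t). (2 * of_real t * exp (- (2 * a * of_real t)) / (1 + exp (- (2 * a * of_real t)))) / of_real (1 + t\<^sup>2))"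
      using one_plus_exp_neq_0 one_plus_power2_neq_0 unfolding split_def
      by (intro continuous_intros) (auto simp del: of_real_add)
  qed (rule convex_halfspace_Re_gt)
  thus ?thesis
  proof (rule holomorphic_transform)
    show "integral (cbox 0 (real n)) (\<lambda>t. ln_exp_sech a t / of_real (1 + t\<^sup>2)) = (LINT t:{0..real n}|lborel. ln_exp_sech a t / of_real (1 + t\<^sup>2))"
      if "a \<in> {a. Re a > 0}" for a
      using set_borel_integral_eq_integral(2)[OF borel_integrable_atLeastAtMost'[OF cont]] that by simp
  qed
qed

text \<open>The integrals over \<open>[0, n]\<close> are holomorphic by the Leibniz rule, and on \<open>Re a \<ge> \<delta>\<close> they converge
  uniformly, since the tails are dominated by those of \<open>2 / (1 + t\<^sup>2)\<close>.\<close>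

lemma holomorphic_on_ln_exp_sech_integral:
  "(\<lambda>a. LINT t:{0<..}|lborel. ln_exp_sech a t / of_real (1 + t\<^sup>2)) holomorphic_on {a. Re a > 0}"
proof (rule holomorphic_uniform_sequence[OF open_halfspace_Re_gt])
  show "(\<lambda>a. LINT t:{0..real n}|lborel. ln_exp_sech a t / of_real (1 + t\<^sup>2)) holomorphic_on {a. Re a > 0}" for n
    by (rule holomorphic_on_ln_exp_sech_integral_Icc)
next
  fix z assume z: "z \<in> {a. Re a > 0}"
  define \<delta> where "\<delta> = Re z / 2"
  have \<delta>: "\<delta> > 0" using z by (simp add: \<delta>_def)
  have Re_ge: "Re a \<ge> \<delta>" if "a \<in> cball z \<delta>" for a
  proof -
    have "\<bar>Re (z - a)\<bar> \<le> \<delta>" 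
      using that order_trans[OF abs_Re_le_cmod[of "z - a"]] by (simp add: dist_norm)
    thus ?thesis unfolding \<delta>_def minus_complex.simps by linarith
  qed
  have est: "dist (LINT t:{0..real n}|lborel. ln_exp_sech a t / of_real (1 + t\<^sup>2)) (LINT t:{0<..}|lborel. ln_exp_sech a t / of_real (1 + t\<^sup>2))
      \<le> (LINT t:{real n<..}|lborel. 2 * (1 / (1 + t\<^sup>2)))" if a: "a \<in> cball z \<delta>" and n: "real n \<ge> 1 / \<delta>" for a n
  proof -
    let ?g = "\<lambda>t. ln_exp_sech a t / of_real (1 + t\<^sup>2)"
    have "Re a > 0" using Re_ge[OF a] \<delta> by linarith
    note int = set_integrable_ln_exp_sech[OF this]
    have i1: "set_integrable lborel {0<..real n} ?g" by (rule set_integrable_subset[OF int]) auto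
    have i2: "set_integrable lborel {real n<..} ?g" by (rule set_integrable_subset[OF int]) auto
    have i3: "set_integrable lborel {real n<..} (\<lambda>t. 2 * (1 / (1 + t\<^sup>2)))"
      by (intro set_integrable_mult_right set_integrable_subset[OF set_integrable_Ioi_cauchy]) auto
    have un: "{0<..real n} \<union> {real n<..} = {0<..}" by auto
    have "(LINT t:{0<..real n} \<union> {real n<..}|lborel. ?g t) = (LINT t:{0<..real n}|lborel. ?g t) + (LINT t:{real n<..}|lborel. ?g t)"
      by (rule set_integral_Un[OF _ i1 i2]) auto
    hence "(LINT t:{0<..}|lborel. ?g t) = (LINT t:{0<..real n}|lborel. ?g t) + (LINT t:{real n<..}|lborel. ?g t)"
      unfolding un .
    moreover have "(LINT t:{0..real n}|lborel. ?g t) = (LINT t:{0<..real n}|lborel. ?g t)"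
      by (rule set_integral_discrete_difference[where X = "{0}"]) auto
    ultimately have "dist (LINT t:{0..real n}|lborel. ?g t) (LINT t:{0<..}|lborel. ?g t) = norm (LINT t:{real n<..}|lborel. ?g t)"
      by (simp add: dist_norm)
    also have "\<dots> \<le> (LINT t:{real n<..}|lborel. norm (?g t))" by (rule set_integral_norm_bound[OF i2])
    also have "\<dots> \<le> (LINT t:{real n<..}|lborel. 2 * (1 / (1 + t\<^sup>2)))"
    proof (rule set_integral_mono[OF _ i3])
      show "set_integrable lborel {real n<..} (\<lambda>t. norm (?g t))"
        using i2 unfolding set_integrable_def by (drule_tac integrable_norm) simp
      fix t assume "t \<in> {real n<..}"
      hence "norm (ln_exp_sech a t) \<le> 2" using n by (intro norm_ln_exp_sech_le_2[OF \<delta> Re_ge[OF a]]) auto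
      moreover have "1 + t\<^sup>2 > 0" by (intro add_pos_nonneg) auto
      hence "norm (?g t) = norm (ln_exp_sech a t) / (1 + t\<^sup>2)"
        unfolding norm_divide norm_of_real by simp
      ultimately show "norm (?g t) \<le> 2 * (1 / (1 + t\<^sup>2))"
        using \<open>1 + t\<^sup>2 > 0\<close> by (simp add: divide_right_mono)
    qed
    finally show ?thesis .
  qed
  show "\<exists>d>0. cball z d \<subseteq> {a. Re a > 0} \<and> uniform_limit (cball z d)
      (\<lambda>n a. LINT t:{0..real n}|lborel. ln_exp_sech a t / of_real (1 + t\<^sup>2))
      (\<lambda>a. LINT t:{0<..}|lborel. ln_exp_sech a t / of_real (1 + t\<^sup>2)) sequentially"
  proof (intro exI[of _ \<delta>] conjI uniform_limitI \<delta>)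
    show "cball z \<delta> \<subseteq> {a. Re a > 0}" using Re_ge \<delta> by (metis (mono_tags) mem_Collect_eq order_less_le_trans subsetI)
    fix e :: real assume "e > 0"
    have "\<forall>\<^sub>F n in sequentially. (LINT t:{real n<..}|lborel. 2 * (1 / (1 + t\<^sup>2))) < e"
      by (rule order_tendstoD(2)[OF cauchy_tail_tendsto_0 \<open>e > 0\<close>])
    moreover have "\<forall>\<^sub>F n in sequentially. real n \<ge> 1 / \<delta>" by real_asymp
    ultimately show "\<forall>\<^sub>F n in sequentially. \<forall>a\<in>cball z \<delta>.
        dist (LINT t:{0..real n}|lborel. ln_exp_sech a t / of_real (1 + t\<^sup>2)) (LINT t:{0<..}|lborel. ln_exp_sech a t / of_real (1 + t\<^sup>2)) < e"
      by eventually_elim (use est in fastforce)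
  qed
qed

section \<open>Analytic continuation and scaling\<close>

lemma ln_exp_sech_integral_of_real:
  fixes x :: real
  assumes "x > 0"
  shows "(LINT t:{0<..}|lborel. ln_exp_sech (of_real x) t / of_real (1 + t\<^sup>2)) =
    of_real (pi * (ln_Gamma (1/2 + x / pi) - ln (sqrt pi)) + x * (ln (pi / x) + 1))"
proof -
  define s where "s = x / pi"
  have s: "s > 0" using assms by (simp add: s_def)
  have xs: "x = pi * s" by (simp add: s_def)
  let ?L = "\<lambda>t. ln (1 + exp (- (2 * pi * s * t))) / (1 + t\<^sup>2)"
  have "(LINT t:{0<..}|lborel. ln_exp_sech (of_real x) t / of_real (1 + t\<^sup>2)) =
      (LINT t:{0<..}|lborel. complex_of_real (ln 2 * (1 / (1 + t\<^sup>2)) - ?L t))"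
    unfolding ln_exp_sech_of_real xs by (simp add: diff_divide_distrib mult.assoc)
  also have "\<dots> = of_real (LINT t:{0<..}|lborel. ln 2 * (1 / (1 + t\<^sup>2)) - ?L t)"
    by (rule set_integral_complex_of_real)
  also have "(LINT t:{0<..}|lborel. ln 2 * (1 / (1 + t\<^sup>2)) - ?L t) =
      (LINT t:{0<..}|lborel. ln 2 * (1 / (1 + t\<^sup>2))) - (LINT t:{0<..}|lborel. ?L t)"
    by (intro set_integral_diff(2) set_integrable_mult_right set_integrable_Ioi_cauchy
          log_integral_eq_laplace(1)[OF s])
  also have "\<dots> = ln 2 * (pi / 2) - pi * laplace binet_kernel s"
    unfolding log_integral_eq_laplace(2)[OF s] set_integral_mult_right set_integral_Ioi_cauchy ..
  also have "\<dots> = pi * (ln_Gamma (1/2 + s) - ln (sqrt pi)) + x * (ln (1 / s) + 1)"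
    unfolding laplace_binet_kernel[OF s] xs using s
    by (simp add: ln_mult ln_div ln_sqrt algebra_simps add_divide_distrib)
  also have "1 / s = pi / x" by (simp add: s_def)
  finally show ?thesis unfolding s_def .
qed

text \<open>Both sides are holomorphic in the right half-plane and agree on the positive real axis.\<close>

lemma ln_exp_sech_integral:
  assumes "Re a > 0"
  shows "(LINT t:{0<..}|lborel. ln_exp_sech a t / of_real (1 + t\<^sup>2)) =
    of_real pi * (ln_Gamma (1/2 + a / of_real pi) - of_real (ln (sqrt pi))) + a * (Ln (of_real pi / a) + 1)"
proof -
  let ?H = "{z. Re z > 0}" and ?U = "complex_of_real ` {0<..}"
  let ?J = "\<lambda>a. LINT t:{0<..}|lborel. ln_exp_sech a t / of_real (1 + t\<^sup>2)"
  let ?R = "\<lambda>a. of_real pi * (ln_Gamma (1/2 + a / of_real pi) - of_real (ln (sqrt pi))) + a * (Ln (of_real pi / a) + 1)"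
  have eq: "?J z - ?R z = 0" if "z \<in> ?U" for z
  proof -
    obtain x where x: "x > 0" "z = of_real x" using \<open>z \<in> ?U\<close> by auto
    have "ln_Gamma (1/2 + z / of_real pi) = of_real (ln_Gamma (1/2 + x / pi))"
      using ln_Gamma_complex_of_real[of "1/2 + x / pi"] x by (simp add: add_pos_pos)
    moreover have "Ln (of_real pi / z) = of_real (ln (pi / x))"
      using Ln_of_real[of "pi / x"] x by simp
    ultimately show ?thesis
      unfolding x(2) ln_exp_sech_integral_of_real[OF x(1)] by simp
  qed
  have "?J holomorphic_on ?H" by (rule holomorphic_on_ln_exp_sech_integral)
  moreover have "?R holomorphic_on ?H"
  proof -
    have "1/2 + z / of_real pi \<notin> \<real>\<^sub>\<le>\<^sub>0" if "Re z > 0" for z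
    proof -
      have "Re (1/2 + z / of_real pi) > 0" using that by (simp add: add_pos_pos)
      thus ?thesis unfolding complex_nonpos_Reals_iff by linarith
    qed
    hence "(\<lambda>z. ln_Gamma (1/2 + z / of_real pi)) holomorphic_on ?H"
      unfolding holomorphic_on_def field_differentiable_def
      by (auto intro!: exI derivative_eq_intros)
    moreover have "of_real pi / z \<notin> \<real>\<^sub>\<le>\<^sub>0" if "Re z > 0" for z :: complex
    proof -
      have "Re (of_real pi / z) > 0" using that by (auto simp: Re_divide intro!: divide_pos_pos mult_pos_pos add_pos_nonneg)
      thus ?thesis unfolding complex_nonpos_Reals_iff by linarith
    qed
    ultimately show ?thesis by (intro holomorphic_intros) auto
  qed
  ultimately have "(\<lambda>z. ?J z - ?R z) holomorphic_on ?H" by (rule holomorphic_on_diff)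
  moreover have "open ?H" by (rule open_halfspace_Re_gt)
  moreover have "connected ?H" by (rule convex_connected[OF convex_halfspace_Re_gt])
  moreover have "?U \<subseteq> ?H" by auto
  moreover have "1 \<in> ?H" by simp
  moreover have "1 islimpt ?U"
    unfolding islimpt_approachable
  proof (intro allI impI)
    fix e :: real assume "e > 0"
    then have "complex_of_real (1 + e/2) \<in> ?U" by (intro imageI) simp
    moreover have "complex_of_real (1 + e/2) \<noteq> 1"
      using \<open>e > 0\<close> by (metis add_cancel_left_right half_gt_zero less_irrefl of_real_eq_1_iff)
    moreover have "dist (complex_of_real (1 + e/2)) 1 < e"
      using \<open>e > 0\<close> by (simp add: dist_norm norm_divide)
    ultimately show "\<exists>x'\<in>?U. x' \<noteq> 1 \<and> dist x' 1 < e" by blast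
  qed
  ultimately have "?J a - ?R a = 0"
    by (rule analytic_continuation) (use eq assms in auto)
  thus ?thesis by simp
qed

text \<open>The substitution \<open>t \<mapsto> b t\<close> with real \<open>b\<close> turns the pair \<open>(a, b)\<close> into \<open>(a b, 1)\<close>.\<close>

lemma ln_exp_sech_integral_scaled:
  assumes "Re a > 0" "b > 0"
  shows "set_integrable lborel {0<..} (\<lambda>t. ln_exp_sech a t / of_real (t\<^sup>2 + b\<^sup>2))"
    and "(LINT t:{0<..}|lborel. ln_exp_sech a t / of_real (t\<^sup>2 + b\<^sup>2)) =
      of_real pi / of_real b * (ln_Gamma (1/2 + a * of_real b / of_real pi) - of_real (ln (sqrt pi)))
        + a * (Ln (of_real pi / (a * of_real b)) + 1)"
proof -
  let ?f = "\<lambda>t. ln_exp_sech a t / of_real (t\<^sup>2 + b\<^sup>2)"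
  let ?g = "\<lambda>t. ln_exp_sech (a * of_real b) t / of_real (1 + t\<^sup>2)"
  have ab: "Re (a * of_real b) > 0" using assms by simp
  have fg: "?f (b * t) = of_real (1 / b\<^sup>2) * ?g t" for t
  proof -
    have "(b * t)\<^sup>2 + b\<^sup>2 = b\<^sup>2 * (1 + t\<^sup>2)" by (simp add: power_mult_distrib algebra_simps)
    moreover have "ln_exp_sech a (b * t) = ln_exp_sech (a * of_real b) t"
      by (simp add: ln_exp_sech_def mult.assoc)
    ultimately show ?thesis by (simp only: of_real_mult of_real_divide of_real_1) simp
  qed
  show "set_integrable lborel {0<..} ?f"
    using set_integral_Ioi_scale(1)[OF assms(2), of ?f]
      set_integrable_mult_right[OF set_integrable_ln_exp_sech[OF ab], of "of_real (1 / b\<^sup>2)"]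
    unfolding fg by blast
  have "(LINT t:{0<..}|lborel. ?f t) = b *\<^sub>R (of_real (1 / b\<^sup>2) * (LINT t:{0<..}|lborel. ?g t))"
    using set_integral_Ioi_scale(2)[OF assms(2), of ?f] unfolding fg set_integral_mult_right .
  also have "\<dots> = of_real (1 / b) * (LINT t:{0<..}|lborel. ?g t)"
    using assms(2) by (simp add: scaleR_conv_of_real power2_eq_square)
  also have "\<dots> = of_real pi / of_real b * (ln_Gamma (1/2 + a * of_real b / of_real pi) - of_real (ln (sqrt pi)))
        + a * (Ln (of_real pi / (a * of_real b)) + 1)"
    unfolding ln_exp_sech_integral[OF ab] using assms(2) by (simp add: field_simps)
  finally show "(LINT t:{0<..}|lborel. ?f t) = of_real pi / of_real b * (ln_Gamma (1/2 + a * of_real b / of_real pi) - of_real (ln (sqrt pi)))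
        + a * (Ln (of_real pi / (a * of_real b)) + 1)" .
qed

section \<open>Integration by parts\<close>

lemma one_minus_tanh_eq:
  assumes "Re a > 0" "t \<ge> 0"
  shows "1 - tanh (a * of_real t) = 2 * exp (- (2 * a * of_real t)) / (1 + exp (- (2 * a * of_real t)))"
proof -
  let ?e = "exp (a * complex_of_real t)" and ?w = "exp (- (2 * a * complex_of_real t))"
  have w: "exp (- (a * of_real t)) = ?e * ?w"
    unfolding exp_add[symmetric] by (simp add: algebra_simps)
  have nz: "1 + ?w \<noteq> 0" by (rule one_plus_exp_neq_0[OF assms])
  have "sinh (a * of_real t) = ?e * (1 - ?w) / 2" "cosh (a * of_real t) = ?e * (1 + ?w) / 2"
    unfolding sinh_def cosh_def w by (simp_all add: scaleR_conv_of_real algebra_simps)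
  hence "tanh (a * of_real t) = (?e * (1 - ?w) / 2) / (?e * (1 + ?w) / 2)"
    by (simp only: tanh_def)
  also have "\<dots> = (1 - ?w) / (1 + ?w)" by simp
  finally show ?thesis using nz by (simp add: divide_simps left_diff_distrib)
qed

lemma continuous_on_one_minus_tanh_arctan:
  fixes b :: real
  assumes "Re a > 0"
  shows "continuous_on {0<..} (\<lambda>t. (1 - tanh (a * of_real t)) * of_real (arctan (b / t)))"
proof -
  have "continuous_on {0<..} (\<lambda>t. (2 * exp (- (2 * a * of_real t)) / (1 + exp (- (2 * a * of_real t)))) * of_real (arctan (b / t)))"
    using one_plus_exp_neq_0[OF assms] by (intro continuous_intros) auto
  thus ?thesis by (rule continuous_on_eq) (use one_minus_tanh_eq[OF assms] in auto)
qed

text \<open>The integrand decays like \<open>exp (- 2 Re a t)\<close>, because \<open>1 / (1 + exp (- 2 a t))\<close> stays bounded: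
  on a compact interval by continuity, and afterwards because the exponential is below \<open>1/2\<close>.\<close>

lemma set_integrable_one_minus_tanh_arctan:
  fixes b :: real
  assumes "Re a > 0"
  shows "set_integrable lborel {0<..} (\<lambda>t. (1 - tanh (a * of_real t)) * of_real (arctan (b / t)))"
proof -
  let ?w = "\<lambda>t. exp (- (2 * a * complex_of_real t))"
  have "continuous_on {0..} (\<lambda>t. inverse (1 + ?w t))"
    using one_plus_exp_neq_0[OF assms] by (intro continuous_intros) auto
  moreover have "norm (inverse (1 + ?w t)) \<le> 2" if "t \<ge> 1 / Re a" for t
  proof -
    have "norm (?w t) < 1 / 2" by (rule norm_exp_2mult_small[OF assms order_refl that])
    hence "norm (1 + ?w t) \<ge> 1 / 2" using norm_diff_ineq[of 1 "?w t"] by simp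
    hence "inverse (norm (1 + ?w t)) \<le> inverse (1 / 2)" by (intro le_imp_inverse_le) auto
    thus ?thesis by (simp only: norm_inverse) simp
  qed
  ultimately obtain C where C: "C > 0" "\<And>t. t \<ge> 0 \<Longrightarrow> norm (inverse (1 + ?w t)) \<le> C"
    using bounded_on_Ici_if_eventually_bounded by blast
  show ?thesis
  proof (rule set_integrable_bound)
    show "set_integrable lborel {0<..} (\<lambda>t. (2 * C * (pi / 2)) * exp (- (t * (2 * Re a))))"
      using assms by (intro set_integrable_mult_right integrable_I0i_exp_mscale) auto
    show "set_borel_measurable lborel {0<..} (\<lambda>t. (1 - tanh (a * of_real t)) * of_real (arctan (b / t)))"
      unfolding set_borel_measurable_def measurable_lborel2
      by (intro borel_measurable_continuous_on_indicator continuous_on_one_minus_tanh_arctan assms) auto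
    show "AE t in lborel. t \<in> {0<..} \<longrightarrow> norm ((1 - tanh (a * of_real t)) * of_real (arctan (b / t))) \<le> norm ((2 * C * (pi / 2)) * exp (- (t * (2 * Re a))))"
    proof (rule AE_I2, rule impI)
      fix t :: real assume "t \<in> {0<..}"
      hence t: "t \<ge> 0" by simp
      have "norm (1 - tanh (a * of_real t)) = 2 * exp (- (2 * Re a * t)) * norm (inverse (1 + ?w t))"
        unfolding one_minus_tanh_eq[OF assms t] divide_inverse norm_mult norm_exp_2mult by simp
      also have "\<dots> \<le> 2 * exp (- (2 * Re a * t)) * C"
        using C(2)[OF t] by (intro mult_left_mono) auto
      finally have "norm (1 - tanh (a * of_real t)) \<le> 2 * exp (- (2 * Re a * t)) * C" .
      moreover have "norm (complex_of_real (arctan (b / t))) \<le> pi / 2"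
        unfolding norm_of_real using arctan_bounded[of "b / t"] by linarith
      ultimately have "norm ((1 - tanh (a * of_real t)) * of_real (arctan (b / t))) \<le> (2 * exp (- (2 * Re a * t)) * C) * (pi / 2)"
        unfolding norm_mult using C(1) by (intro mult_mono) auto
      also have "\<dots> = norm ((2 * C * (pi / 2)) * exp (- (t * (2 * Re a))))"
        using C(1) by (simp add: abs_mult mult_ac)
      finally show "norm ((1 - tanh (a * of_real t)) * of_real (arctan (b / t))) \<le> norm ((2 * C * (pi / 2)) * exp (- (t * (2 * Re a))))" .
    qed
  qed
qed

text \<open>\<open>ln_exp_sech a t\<close> is an antiderivative of \<open>a (1 - tanh (a t))\<close> in \<open>t\<close>. The boundary terms vanish:
  at 0 because \<open>ln_exp_sech a 0 = 0\<close>, at infinity because \<open>ln_exp_sech a\<close> is bounded and the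
  arctangent tends to 0.\<close>

lemma one_minus_tanh_arctan_by_parts:
  fixes b :: real
  assumes a: "Re a > 0" and b: "b > 0"
  shows "a * (LINT t:{0<..}|lborel. (1 - tanh (a * of_real t)) * of_real (arctan (b / t))) =
    of_real b * (LINT t:{0<..}|lborel. ln_exp_sech a t / of_real (t\<^sup>2 + b\<^sup>2))"
proof -
  let ?k = "\<lambda>t. (1 - tanh (a * of_real t)) * of_real (arctan (b / t))"
  let ?g = "\<lambda>t. ln_exp_sech a t / of_real (t\<^sup>2 + b\<^sup>2)"
  let ?P = "\<lambda>t. ln_exp_sech a t * of_real (arctan (b / t))"
  have nz: "t\<^sup>2 + b\<^sup>2 \<noteq> 0" for t using b zero_le_power2[of t] zero_less_power[OF b, of 2] by linarith
  have ik: "set_integrable lborel {0<..} (\<lambda>t. a * ?k t)"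
    by (intro set_integrable_mult_right set_integrable_one_minus_tanh_arctan a)
  have ig: "set_integrable lborel {0<..} (\<lambda>t. of_real b * ?g t)"
    by (intro set_integrable_mult_right ln_exp_sech_integral_scaled(1) a b)
  have int: "set_integrable lborel {0<..} (\<lambda>t. a * ?k t - of_real b * ?g t)"
    by (rule set_integral_diff(1)[OF ik ig])
  have deriv: "(?P has_vector_derivative (a * ?k t - of_real b * ?g t)) (at t)" if t: "t > 0" for t
  proof -
    have n: "1 + exp (- (2 * a * of_real t)) \<notin> \<real>\<^sub>\<le>\<^sub>0"
      using one_plus_exp_notin_nonpos_Reals[OF a] t by simp
    have "((\<lambda>z. of_real (ln 2) - Ln (1 + exp (- (2 * a * z)))) has_field_derivative
        a * (2 * exp (- (2 * a * of_real t)) / (1 + exp (- (2 * a * of_real t))))) (at (of_real t))"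
      using n by (auto intro!: derivative_eq_intros simp: divide_inverse mult_ac)
    from has_vector_derivative_real_field[OF this]
    have 1: "(ln_exp_sech a has_vector_derivative a * (1 - tanh (a * of_real t))) (at t)"
      unfolding ln_exp_sech_def[abs_def] using one_minus_tanh_eq[OF a, of t] t by simp
    have "((\<lambda>t. arctan (b / t)) has_real_derivative (- b / (t\<^sup>2 + b\<^sup>2))) (at t)"
    proof -
      have "((\<lambda>t. arctan (b / t)) has_real_derivative inverse (1 + (b / t)\<^sup>2) * (- b / t\<^sup>2)) (at t)"
        using t by (auto intro!: derivative_eq_intros simp: power2_eq_square)
      moreover have "inverse (1 + (b / t)\<^sup>2) * (- b / t\<^sup>2) = - b / (t\<^sup>2 + b\<^sup>2)"
      proof -
        have "t\<^sup>2 * (1 + (b / t)\<^sup>2) = t\<^sup>2 + b\<^sup>2" using t by (simp add: power_divide distrib_left)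
        moreover have "inverse (1 + (b / t)\<^sup>2) * (- b / t\<^sup>2) = - b / (t\<^sup>2 * (1 + (b / t)\<^sup>2))"
          by (simp add: divide_inverse)
        ultimately show ?thesis by (simp only:)
      qed
      ultimately show ?thesis by (simp only:)
    qed
    hence "((\<lambda>t. complex_of_real (arctan (b / t))) has_vector_derivative of_real (- b / (t\<^sup>2 + b\<^sup>2))) (at t)"
      by (intro has_vector_derivative_of_real) (simp add: has_real_derivative_iff_has_vector_derivative)
    from has_vector_derivative_mult[OF 1 this] show ?thesis
      by (rule has_vector_derivative_eq_rhs) (simp add: algebra_simps)
  qed
  have cont: "isCont (\<lambda>t. a * ?k t - of_real b * ?g t) t" if "t > 0" for t
  proof -
    have "continuous_on {0<..} (ln_exp_sech a)"
      by (rule continuous_on_subset[OF continuous_on_ln_exp_sech[OF a]]) auto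
    hence "continuous_on {0<..} (\<lambda>t. a * ?k t - of_real b * ?g t)"
      using nz by (intro continuous_on_diff continuous_on_mult continuous_on_const continuous_on_one_minus_tanh_arctan[OF a]
          continuous_on_divide continuous_on_of_real continuous_on_add continuous_on_power continuous_on_id)
        (auto simp del: of_real_add)
    thus ?thesis using that by (simp add: continuous_on_eq_continuous_at)
  qed
  have "(?P \<longlongrightarrow> 0) (at_right 0)"
  proof (rule Lim_null_comparison)
    show "\<forall>\<^sub>F t in at_right 0. norm (?P t) \<le> norm (ln_exp_sech a t) * (pi / 2)"
    proof (intro always_eventually allI)
      fix t
      have "norm (complex_of_real (arctan (b / t))) \<le> pi / 2"
        unfolding norm_of_real using arctan_bounded[of "b / t"] by linarith
      thus "norm (?P t) \<le> norm (ln_exp_sech a t) * (pi / 2)"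
        unfolding norm_mult by (intro mult_left_mono) auto
    qed
    have "Ln 2 = complex_of_real (ln 2)" using Ln_of_real[of 2] by simp
    hence "ln_exp_sech a 0 = 0" by (simp add: ln_exp_sech_def)
    moreover have "(ln_exp_sech a \<longlongrightarrow> ln_exp_sech a 0) (at 0 within {0..})"
      using continuous_on_ln_exp_sech[OF a] by (simp add: continuous_on_def)
    ultimately have "(ln_exp_sech a \<longlongrightarrow> 0) (at_right 0)"
      by (metis at_within_Ici_at_right)
    from tendsto_mult[OF tendsto_norm[OF this] tendsto_const[of "pi / 2"]]
    show "((\<lambda>t. norm (ln_exp_sech a t) * (pi / 2)) \<longlongrightarrow> 0) (at_right 0)" by simp
  qed
  moreover have "(?P \<longlongrightarrow> 0) at_top"
  proof -
    obtain C where C: "C > 0" "\<And>t. t \<ge> 0 \<Longrightarrow> norm (ln_exp_sech a t) \<le> C"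
      using ln_exp_sech_bounded[OF a] by blast
    show ?thesis
    proof (rule Lim_null_comparison)
      show "\<forall>\<^sub>F t in at_top. norm (?P t) \<le> C * \<bar>arctan (b / t)\<bar>"
        using eventually_ge_at_top[of 0]
        by eventually_elim (use C(2) in \<open>auto simp: norm_mult intro!: mult_right_mono\<close>)
      show "((\<lambda>t. C * \<bar>arctan (b / t)\<bar>) \<longlongrightarrow> 0) at_top"
      proof -
        have "((\<lambda>t. b / t) \<longlongrightarrow> 0) at_top" by real_asymp
        hence "((\<lambda>t. C * \<bar>arctan (b / t)\<bar>) \<longlongrightarrow> C * \<bar>arctan 0\<bar>) at_top" by (intro tendsto_intros)
        thus ?thesis by simp
      qed
    qed
  qed
  ultimately have "(LBINT t=0..\<infinity>. a * ?k t - of_real b * ?g t) = 0 - 0"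
    using deriv cont int
    by (intro interval_integral_FTC_integrable[where F = ?P])
       (auto simp: zero_ereal_def ereal_tendsto_simps)
  hence "(LINT t:{0<..}|lborel. a * ?k t - of_real b * ?g t) = 0"
    by (simp add: interval_lebesgue_integral_0_infty)
  hence "(LINT t:{0<..}|lborel. a * ?k t) = (LINT t:{0<..}|lborel. of_real b * ?g t)"
    unfolding set_integral_diff(2)[OF ik ig] by simp
  thus ?thesis unfolding set_integral_mult_right .
qed

theorem proposition4:
  fixes y :: real and a :: complex
  assumes "y \<noteq> 0" and "Re a > 0"
  shows "((\<lambda>t::real. (1 - tanh (a * of_real t)) * of_real (arctan (\<bar>y\<bar> / t)))
            has_integral
          (of_real pi / a
             * ln_branch (\<lambda>z. Gamma (1/2 + z * of_real \<bar>y\<bar> / of_real pi) / of_real (sqrt pi)) a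
           + of_real \<bar>y\<bar> * (ln_branch (\<lambda>z. of_real pi / (z * of_real \<bar>y\<bar>)) a + 1))) {0<..} \<and>
         ((\<lambda>t::real. ln_branch (\<lambda>z. exp (z * of_real t) * inverse (cosh (z * of_real t))) a
                       / of_real (t\<^sup>2 + y\<^sup>2))
            has_integral
          (of_real pi / of_real \<bar>y\<bar>
             * ln_branch (\<lambda>z. Gamma (1/2 + z * of_real \<bar>y\<bar> / of_real pi) / of_real (sqrt pi)) a
           + a * (ln_branch (\<lambda>z. of_real pi / (z * of_real \<bar>y\<bar>)) a + 1))) {0<..}"
proof -
  have y: "\<bar>y\<bar> > 0" using assms(1) by simp
  let ?k = "\<lambda>t. (1 - tanh (a * of_real t)) * of_real (arctan (\<bar>y\<bar> / t))"
  let ?g = "\<lambda>t. ln_exp_sech a t / of_real (t\<^sup>2 + \<bar>y\<bar>\<^sup>2)"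
  define G where "G = ln_branch (\<lambda>z. Gamma (1/2 + z * of_real \<bar>y\<bar> / of_real pi) / of_real (sqrt pi)) a"
  define I where "I = ln_branch (\<lambda>z. of_real pi / (z * of_real \<bar>y\<bar>)) a"
  have g: "(LINT t:{0<..}|lborel. ?g t) = of_real pi / of_real \<bar>y\<bar> * G + a * (I + 1)"
    unfolding G_def I_def ln_branch_Gamma[OF y assms(2)] ln_branch_inverse[OF y assms(2)]
    by (rule ln_exp_sech_integral_scaled(2)[OF assms(2) y])
  have a0: "a \<noteq> 0" using assms(2) by auto
  have "(LINT t:{0<..}|lborel. ?k t) = of_real \<bar>y\<bar> / a * (LINT t:{0<..}|lborel. ?g t)"
    using one_minus_tanh_arctan_by_parts[OF assms(2) y] a0 by (simp add: field_simps)
  also have "\<dots> = of_real pi / a * G + of_real \<bar>y\<bar> * (I + 1)"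
    unfolding g using a0 y by (simp add: field_simps)
  finally have k: "(LINT t:{0<..}|lborel. ?k t) = of_real pi / a * G + of_real \<bar>y\<bar> * (I + 1)" .
  have has: "(f has_integral (LINT t:{0<..}|lborel. f t)) {0<..}" if "set_integrable lborel {0<..} f" for f :: "real \<Rightarrow> complex"
    using set_borel_integral_eq_integral[OF that] by (simp add: has_integral_integral)
  have "(?k has_integral (of_real pi / a * G + of_real \<bar>y\<bar> * (I + 1))) {0<..}"
    using has[OF set_integrable_one_minus_tanh_arctan[OF assms(2), of "\<bar>y\<bar>"]] unfolding k .
  moreover have "((\<lambda>t. ln_branch (\<lambda>z. exp (z * of_real t) * inverse (cosh (z * of_real t))) a / of_real (t\<^sup>2 + y\<^sup>2))
      has_integral (of_real pi / of_real \<bar>y\<bar> * G + a * (I + 1))) {0<..}"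
  proof (rule has_integral_eq)
    show "(?g has_integral (of_real pi / of_real \<bar>y\<bar> * G + a * (I + 1))) {0<..}"
      using has[OF ln_exp_sech_integral_scaled(1)[OF assms(2) y]] unfolding g .
    show "?g t = ln_branch (\<lambda>z. exp (z * of_real t) * inverse (cosh (z * of_real t))) a / of_real (t\<^sup>2 + y\<^sup>2)"
      if "t \<in> {0<..}" for t
      using ln_branch_exp_sech_eq[OF _ assms(2), of t] that by simp
  qed
  ultimately show ?thesis unfolding G_def I_def by blast
qed

end
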